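(* Let $\mathbf{u}=(u_1,\dots,u_n)$ be a nonzero vector with $0\le u_1\le\cdots\le u_n$. Suppose that $\mathrm{PF}(\mathbf{u})$ is $n$-dimensional and that $\mathrm{PF}(\mathbf{u})=y_1\Delta^0_{I_1}+\cdots+y_m\Delta^0_{I_m}$, where $I_1,\dots,I_m$ are distinct nonempty subsets of $[n]$ such that the real numbers $y_k:=y_{I_k}$, with $$y_I=\sum_{j=0}^{|I|-1}\binom{|I|-1}{j}(-1)^j u_{|I|-j},$$ are all nonzero. Then the volume of $\mathrm{PF}(\mathbf{u})$ is $$\sum_{\substack{\mathbf{a}\in D(\mathrm{PF}(\mathbf{u}))\\ a_1+\cdots+a_m=n}}\frac{y_1^{a_1}}{a_1!}\cdots\frac{y_m^{a_m}}{a_m!},$$ where $D(\mathrm{PF}(\mathbf{u}))$ is the set of all $\mathbf{a}=(a_1,\dots,a_m)\in\mathbb{Z}^m_{\ge0}$ satisfying $\sum_{j\in J}a_j\le\left|\bigcup_{j\in J}I_j\right|$ for all nonempty subsets $J\subseteq[m]$.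
   Context: $[n]=\{1,\dots,n\}$. For a nonzero vector $\mathbf{u}=(u_1,\dots,u_n)\in\mathbb{R}^n$ with $0\le u_1\le\cdots\le u_n$, a vector $\mathbf{a}\in\mathbb{R}^n_{\ge0}$ with nondecreasing rearrangement $b_1\le\cdots\le b_n$ is a $\mathbf{u}$-parking function if $b_i\le u_i$ for all $i$; $\mathrm{PF}(\mathbf{u})\subset\mathbb{R}^n$ is the convex hull of all $\mathbf{u}$-parking functions. For nonempty $I\subseteq[n]$, $\Delta^0_I=\mathrm{conv}(\{\mathbf{0}\}\cup\{\mathbf{e}_i : i\in I\})$. Sums are Minkowski sums and differences: $P=\sum_k y_k\Delta^0_{I_k}$ means $P+\sum_{y_k<0}(-y_k)\Delta^0_{I_k}=\sum_{y_k>0}y_k\Delta^0_{I_k}$ as Minkowski sums. Volume is $n$-dimensional Lebesgue measure. *)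

theory Defs
  imports "HOL-Analysis.Analysis" "HOL-Library.Multiset" "HOL-Library.Set_Algebras"
begin

text \<open>
  Vectors of the ambient space \<open>\<real>\<^sup>n\<close> have type \<open>real ^ 'n\<close>, with \<open>n = CARD('n)\<close>, and subsets of
  \<open>{1, \<dots>, n}\<close> are sets of type \<open>'n set\<close>. The order of the coordinates matters only for the
  parameter vector \<open>u = (u\<^sub>1, \<dots>, u\<^sub>n)\<close>, which is therefore a function on \<open>nat\<close>; only its values
  on \<open>{1..CARD('n)}\<close> are ever used.
\<close>

text \<open>The nondecreasing rearrangement \<open>b\<^sub>1 \<le> \<dots> \<le> b\<^sub>n\<close> of the coordinates of a vector, indexed from 1.\<close>

definition rearrangement :: "real ^ 'n \<Rightarrow> nat \<Rightarrow> real" where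
  "rearrangement a i =
     sorted_list_of_multiset (image_mset (\<lambda>j. a $ j) (mset_set UNIV)) ! (i - 1)"

definition is_parking_function :: "(nat \<Rightarrow> real) \<Rightarrow> real ^ 'n \<Rightarrow> bool" where
  "is_parking_function u a \<longleftrightarrow>
     (\<forall>j. 0 \<le> a $ j) \<and> (\<forall>i\<in>{1..CARD('n)}. rearrangement a i \<le> u i)"

definition PF :: "(nat \<Rightarrow> real) \<Rightarrow> (real ^ 'n) set" where
  "PF u = convex hull {a. is_parking_function u a}"

definition simplex0 :: "'n set \<Rightarrow> (real ^ 'n) set" where
  "simplex0 I = convex hull ({0} \<union> {axis i 1 | i. i \<in> I})"

text \<open>
  \<open>P = (\<Sum>k\<in>K. y k \<cdot> Q k)\<close> for real coefficients of either sign: the terms with negative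
  coefficients are moved to the other side. Here \<open>+\<close> and \<open>\<Sum>\<close> on sets are the Minkowski
  operations of \<^theory>\<open>HOL-Library.Set_Algebras\<close>; the empty sum is \<open>{0}\<close>.
\<close>

definition is_signed_minkowski_sum ::
    "('v::real_vector) set \<Rightarrow> 'k set \<Rightarrow> ('k \<Rightarrow> real) \<Rightarrow> ('k \<Rightarrow> 'v set) \<Rightarrow> bool" where
  "is_signed_minkowski_sum P K y Q \<longleftrightarrow>
     P + (\<Sum>k\<in>{k\<in>K. y k < 0}. (\<lambda>x. (- y k) *\<^sub>R x) ` Q k)
       = (\<Sum>k\<in>{k\<in>K. y k > 0}. (\<lambda>x. y k *\<^sub>R x) ` Q k)"

definition y_coeff :: "(nat \<Rightarrow> real) \<Rightarrow> 'n set \<Rightarrow> real" where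
  "y_coeff u I =
     (\<Sum>j = 0..card I - 1. real ((card I - 1) choose j) * (- 1) ^ j * u (card I - j))"

text \<open>
  Tuples \<open>(a\<^sub>1, \<dots>, a\<^sub>m)\<close> of nonnegative integers are extensional functions on \<open>{1..m}\<close>, so that
  distinct elements of the set below are distinct tuples.
\<close>

definition draconian :: "nat \<Rightarrow> (nat \<Rightarrow> 'n set) \<Rightarrow> (nat \<Rightarrow> nat) set" where
  "draconian m I =
     {a \<in> {1..m} \<rightarrow>\<^sub>E UNIV.
        \<forall>J. J \<subseteq> {1..m} \<and> J \<noteq> {} \<longrightarrow> (\<Sum>j\<in>J. a j) \<le> card (\<Union>j\<in>J. I j)}"

end

theory Submission
  imports Defs "HOL-Combinatorics.Multiset_Permutations"
begin

text \<open>
  Let \<open>w S\<close> be the maximum of \<open>\<Sum>i\<in>S. x i\<close> over \<open>PF u\<close>. It is the sum of the \<open>|S|\<close> largest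
  entries of \<open>u\<close>, so it is submodular, and \<open>PF u\<close> is the polymatroid
  \<open>{x \<ge> 0. \<forall>S. x(S) \<le> w S}\<close>; since support functions are additive under Minkowski sums, the
  decomposition gives \<open>w S = (\<Sum>k. y k * [S \<inter> I k \<noteq> {}])\<close>. Hence only the polymatroid itself, never
  the summands moved to the other side, has to be measured.

  Slicing along one coordinate turns a polymatroid into a polymatroid of lower dimension, and
  integrating over the slices yields a Lawrence-type formula
  \<open>vol = (\<Sum>\<sigma>. c \<sigma> * (l \<bullet> x \<sigma>) ^ n) / n!\<close> for generic \<open>l\<close>, where \<open>\<sigma>\<close> runs over the orderings of
  \<open>{0, \<dots>, n}\<close>, \<open>x \<sigma>\<close> is the vertex found by the greedy algorithm, and
  \<open>c \<sigma> = 1 / (\<Prod>i. l (\<sigma> i) - l (\<sigma> (i + 1)))\<close>. As \<open>x \<sigma>\<close> is linear in \<open>w\<close>, the volume is a polynomial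
  in the \<open>y k\<close>, whatever their signs, and its coefficients are mixed volumes of the simplices.

  Cutting every ordering in two gives a recursion for these coefficients, free of \<open>l\<close> and with
  nonnegative terms. So they are monotone in the \<open>I k\<close>, at most 1 (all simplices full), at least 1
  if there is a system of distinct representatives (all simplices segments), and 0 if Hall's
  condition fails.
\<close>

section \<open>Coefficients of the volume polynomial\<close>

text \<open>The coefficient \<open>c \<sigma>\<close> of the volume formula: one reciprocal
  difference for each pair of neighbours, meaningful when \<open>l\<close> is injective on the
  list.\<close>

fun weight :: "('a \<Rightarrow> real) \<Rightarrow> 'a list \<Rightarrow> real" where
  "weight l [] = 1"
| "weight l [a] = 1"
| "weight l (a # b # xs) = weight l (b # xs) / (l a - l b)"

text \<open>
  The value of \<open>l\<close> at the first element of the list lying in \<open>J\<close>: the greedy vertex, for the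
  ordering given by the list, of the simplex with vertex set \<open>J\<close>.
\<close>

fun hit :: "('a \<Rightarrow> real) \<Rightarrow> 'a set \<Rightarrow> 'a list \<Rightarrow> real" where
  "hit l J [] = 0"
| "hit l J (a # xs) = (if a \<in> J then l a else hit l J xs)"

text \<open>
  For \<open>|K| = |N| - 1\<close> this is \<open>|K|!\<close> times the mixed volume of the simplices spanned by the
  \<open>J k\<close>, \<open>k \<in> K\<close>, inside the simplex spanned by \<open>N\<close>.
\<close>

definition mixed_coeff :: "('a \<Rightarrow> real) \<Rightarrow> 'a set \<Rightarrow> 'k set \<Rightarrow> ('k \<Rightarrow> 'a set) \<Rightarrow> real" where
  "mixed_coeff l N K J =
     (\<Sum>xs\<in>permutations_of_set N. weight l xs * (\<Prod>k\<in>K. hit l (J k) xs))"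

section \<open>Cutting an ordering into two blocks\<close>

text \<open>Joining two lists creates exactly one new pair of neighbours, hence one new factor in
  the denominator.\<close>

lemma weight_append:
  assumes "ys \<noteq> []" "zs \<noteq> []" "l (last ys) \<noteq> l (hd zs)"
  shows "weight l (ys @ zs) * (l (last ys) - l (hd zs)) = weight l ys * weight l zs"
  using assms
proof (induction l ys rule: weight.induct)
  case (2 l a)
  then show ?case by (cases zs) auto
qed auto

lemma hit_append: "hit l J (ys @ zs) = (if set ys \<inter> J \<noteq> {} then hit l J ys else hit l J zs)"
  by (induction ys) auto

lemma hit_cong: "J \<inter> set xs = J' \<inter> set xs \<Longrightarrow> hit l J xs = hit l J' xs"
  by (induction xs) auto

lemma hit_disjoint: "set xs \<inter> J = {} \<Longrightarrow> hit l J xs = 0"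
  by (induction xs) auto

lemma hit_singleton: "a \<in> set xs \<Longrightarrow> hit l {a} xs = l a"
  by (induction xs) auto

text \<open>Summation by parts: the indicator jumps from 0 to 1 once, when the prefix first reaches
  \<open>J\<close>, and from there on the differences telescope down to
  \<open>l (last xs)\<close>.\<close>

lemma hit_abel:
  assumes "set xs \<inter> J \<noteq> {}"
  shows "hit l J xs = l (last xs) + (\<Sum>i\<in>{1..<length xs}.
     of_bool (set (take i xs) \<inter> J \<noteq> {}) * (l (last (take i xs)) - l (hd (drop i xs))))"
  using assms
proof (induction xs)
  case (Cons a xs)
  show ?case
  proof (cases "xs = []")
    case False
    let ?f = "\<lambda>xs i. of_bool (set (take i xs) \<inter> J \<noteq> {}) * (l (last (take i xs)) - l (hd (drop i xs)))"
    have "(\<Sum>i\<in>{1..<length (a # xs)}. ?f (a # xs) i) = ?f (a # xs) 1 + (\<Sum>i\<in>{Suc 1..<Suc (length xs)}. ?f (a # xs) i)"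
      using False by (subst sum.atLeast_Suc_lessThan) auto
    also have "(\<Sum>i\<in>{Suc 1..<Suc (length xs)}. ?f (a # xs) i) = (\<Sum>i\<in>{1..<length xs}. ?f (a # xs) (Suc i))"
      by (rule sum.shift_bounds_Suc_ivl)
    finally have *: "(\<Sum>i\<in>{1..<length (a # xs)}. ?f (a # xs) i)
       = ?f (a # xs) 1 + (\<Sum>i\<in>{1..<length xs}. ?f (a # xs) (Suc i))" .
    show ?thesis
    proof (cases "a \<in> J")
      case True
      have tel: "(\<Sum>i\<in>{1..<length xs}. l (last (take i xs)) - l (hd (drop i xs))) = l (hd xs) - l (last xs)"
      proof -
        have "(\<Sum>i\<in>{1..<length xs}. l (last (take i xs)) - l (hd (drop i xs)))
          = (\<Sum>i\<in>{Suc 0..<Suc (length xs - 1)}. l (xs ! (i - 1)) - l (xs ! i))"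
          using False by (intro sum.cong) (auto simp: last_conv_nth hd_drop_conv_nth)
        also have "\<dots> = (\<Sum>i\<in>{0..<length xs - 1}. l (xs ! i) - l (xs ! Suc i))"
          by (subst sum.shift_bounds_Suc_ivl) simp
        also have "\<dots> = l (xs ! 0) - l (xs ! (length xs - 1))"
          using sum_lessThan_telescope'[of "\<lambda>i. l (xs ! i)" "length xs - 1"] by (simp add: lessThan_atLeast0)
        finally show ?thesis using False by (simp add: hd_conv_nth last_conv_nth)
      qed
      have "(\<Sum>i\<in>{1..<length xs}. ?f (a # xs) (Suc i)) = (\<Sum>i\<in>{1..<length xs}. l (last (take i xs)) - l (hd (drop i xs)))"
        using True by (intro sum.cong) auto
      with tel * True False show ?thesis by (simp add: hd_conv_nth)
    next
      case a: False
      have "(\<Sum>i\<in>{1..<length xs}. ?f (a # xs) (Suc i)) = (\<Sum>i\<in>{1..<length xs}. ?f xs i)"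
        using a False by (intro sum.cong) auto
      with * a Cons False show ?thesis by simp
    qed
  qed (use Cons in auto)
qed simp

text \<open>An ordering with an interior cut is the same as a proper nonempty subset, an ordering of
  it and an ordering of its complement. The range \<open>{1..<length xs}\<close> keeps both blocks
  nonempty.\<close>

lemma sum_permutations_cut:
  assumes "finite N"
  shows "(\<Sum>xs\<in>permutations_of_set N. \<Sum>i\<in>{1..<length xs}. G (take i xs) (drop i xs)) =
         (\<Sum>S\<in>Pow N - {{}, N}. \<Sum>ys\<in>permutations_of_set S. \<Sum>zs\<in>permutations_of_set (N - S). (G ys zs :: real))"
proof -
  have fS: "finite S" if "S \<in> Pow N" for S using that assms finite_subset by auto
  have "(\<Sum>xs\<in>permutations_of_set N. \<Sum>i\<in>{1..<length xs}. G (take i xs) (drop i xs)) =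
    (\<Sum>(xs, i)\<in>(SIGMA xs:permutations_of_set N. {1..<length xs}). G (take i xs) (drop i xs))"
    by (rule sum.Sigma) auto
  also have "\<dots> = (\<Sum>(S, ys, zs)\<in>(SIGMA S:Pow N - {{}, N}. permutations_of_set S \<times> permutations_of_set (N - S)). G ys zs)"
  proof -
    let ?A = "SIGMA xs:permutations_of_set N. {1..<length xs}"
    let ?B = "SIGMA S:Pow N - {{}, N}. permutations_of_set S \<times> permutations_of_set (N - S)"
    let ?i = "\<lambda>(S, ys, zs). (ys @ zs, length ys)"
    let ?j = "\<lambda>(xs, i). (set (take i xs), take i xs, drop i xs)"
    have j: "?j p \<in> ?B" "?i (?j p) = p" if "p \<in> ?A" for p
    proof -
      obtain xs i where p: "p = (xs, i)" by (cases p)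
      have xs: "xs \<in> permutations_of_set N" and i: "1 \<le> i" "i < length xs" using that p by auto
      have s: "set xs = N" and d: "distinct xs" using xs by (auto simp: permutations_of_set_def)
      have dj: "set (take i xs) \<inter> set (drop i xs) = {}"
        using d by (rule set_take_disj_set_drop_if_distinct) simp
      have un: "set (take i xs) \<union> set (drop i xs) = N"
        using s set_append[of "take i xs" "drop i xs"] by simp
      have ne: "set (take i xs) \<noteq> {}" "set (drop i xs) \<noteq> {}"
        using i by (cases xs; simp)+
      have "B = N - A \<and> A \<noteq> N \<and> A \<subseteq> N" if "A \<inter> B = {}" "A \<union> B = N" "B \<noteq> {}" for A B :: "'a set"
        using that by auto
      from this[OF dj un ne(2)] have 1: "set (drop i xs) = N - set (take i xs)"
        "set (take i xs) \<noteq> N" "set (take i xs) \<subseteq> N" by blast+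
      from 1 ne d show "?j p \<in> ?B"
        unfolding p by (simp add: permutations_of_set_def)
      show "?i (?j p) = p" using i by (simp add: p)
    qed
    have i: "?i q \<in> ?A" "?j (?i q) = q" if "q \<in> ?B" for q
    proof -
      obtain S ys zs where q: "q = (S, ys, zs)" by (cases q)
      have S: "S \<subseteq> N" "S \<noteq> {}" "S \<noteq> N" and ys: "set ys = S" "distinct ys"
        and zs: "set zs = N - S" "distinct zs"
        using that q by (auto simp: permutations_of_set_def)
      have "N - S \<noteq> {}" using S by blast
      hence "ys \<noteq> []" "zs \<noteq> []" using S ys zs by force+
      moreover have "set ys \<union> set zs = N" "set ys \<inter> set zs = {}" using S ys zs by blast+
      ultimately show "?i q \<in> ?A"
        unfolding q using ys(2) zs(2) by (simp add: permutations_of_set_def Suc_le_eq)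
      show "?j (?i q) = q" using ys by (simp add: q)
    qed
    show ?thesis
      by (rule sum.reindex_bij_witness[where i = ?i and j = ?j]) (use i j in \<open>auto simp del: mem_Sigma_iff\<close>)
  qed
  also have "\<dots> = (\<Sum>S\<in>Pow N - {{}, N}. \<Sum>(ys, zs)\<in>permutations_of_set S \<times> permutations_of_set (N - S). G ys zs)"
    using assms by (subst sum.Sigma) (auto simp: split_def)
  finally show ?thesis by (simp add: sum.cartesian_product)
qed

text \<open>
  Summation by parts (\<open>hit_abel\<close>) of the factor belonging to \<open>k\<close> produces a factor
  \<open>l (last ys) - l (hd zs)\<close> for each cut \<open>ys @ zs\<close>, which cancels the only factor of the weight
  linking \<open>ys\<close> to \<open>zs\<close>.
\<close>

lemma mixed_coeff_cut:
  assumes N: "finite N" "inj_on l N" and K: "finite K" "k \<in> K" and v: "v \<in> J k" "v \<in> N"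
  shows "mixed_coeff l N K J = l v * mixed_coeff l N (K - {k}) J +
    (\<Sum>S\<in>Pow N - {{}, N}. (of_bool (S \<inter> J k \<noteq> {}) - of_bool (v \<in> S)) *
       (mixed_coeff l S {j \<in> K - {k}. S \<inter> J j \<noteq> {}} J *
        mixed_coeff l (N - S) {j \<in> K - {k}. S \<inter> J j = {}} J))"
proof -
  define K' where "K' = K - {k}"
  have K': "finite K'" using K by (simp add: K'_def)
  define P where "P xs = (\<Prod>j\<in>K'. hit l (J j) xs)" for xs
  define c where "c S = (of_bool (S \<inter> J k \<noteq> {}) - of_bool (v \<in> S) :: real)" for S
  have prodK: "(\<Prod>j\<in>K. hit l (J j) xs) = hit l (J k) xs * P xs" for xs
    unfolding P_def K'_def using K by (simp add: prod.remove)
  have hit: "hit l (J k) xs = l v + (\<Sum>i\<in>{1..<length xs}.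
      c (set (take i xs)) * (l (last (take i xs)) - l (hd (drop i xs))))"
    if "set xs = N" for xs
  proof -
    have "set xs \<inter> J k \<noteq> {}" using that v by auto
    from hit_abel[OF this, of l] have 1: "hit l (J k) xs = l (last xs) + (\<Sum>i\<in>{1..<length xs}.
      of_bool (set (take i xs) \<inter> J k \<noteq> {}) * (l (last (take i xs)) - l (hd (drop i xs))))" .
    \<comment> \<open>The same identity for the singleton \<open>{v}\<close>, whose hit is always
      \<open>l v\<close>. Subtracting it trades \<open>l (last xs)\<close>, which depends on the
      ordering, for the constant \<open>l v\<close>.\<close>
    have "set xs \<inter> {v} \<noteq> {}" using that v by auto
    from hit_abel[OF this, of l] have 2: "l v = l (last xs) + (\<Sum>i\<in>{1..<length xs}.
      of_bool (v \<in> set (take i xs)) * (l (last (take i xs)) - l (hd (drop i xs))))"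
      using hit_singleton[of v xs l] that v by auto
    show ?thesis unfolding c_def left_diff_distrib sum_subtractf using 1 2 by simp
  qed
  have "mixed_coeff l N K J = (\<Sum>xs\<in>permutations_of_set N. weight l xs *
     ((l v + (\<Sum>i\<in>{1..<length xs}. c (set (take i xs)) * (l (last (take i xs)) - l (hd (drop i xs))))) * P xs))"
    unfolding mixed_coeff_def prodK
    by (intro sum.cong refl) (use hit in \<open>auto simp: permutations_of_set_def\<close>)
  also have "\<dots> = l v * mixed_coeff l N K' J + (\<Sum>xs\<in>permutations_of_set N.
     \<Sum>i\<in>{1..<length xs}. weight l xs * c (set (take i xs)) * (l (last (take i xs)) - l (hd (drop i xs))) * P xs)"
  proof -
    have "weight l xs * ((l v + (\<Sum>i\<in>R. C i * D i)) * P xs) =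
      l v * (weight l xs * P xs) + (\<Sum>i\<in>R. weight l xs * C i * D i * P xs)" for xs R and C D :: "nat \<Rightarrow> real"
    proof -
      have "(\<Sum>i\<in>R. weight l xs * C i * D i * P xs) = weight l xs * (\<Sum>i\<in>R. C i * D i) * P xs"
        by (simp add: sum_distrib_left sum_distrib_right mult.assoc)
      thus ?thesis by (simp add: algebra_simps)
    qed
    thus ?thesis
      unfolding mixed_coeff_def P_def[symmetric] sum_distrib_left sum.distrib[symmetric] by simp
  qed
  also have "(\<Sum>xs\<in>permutations_of_set N.
     \<Sum>i\<in>{1..<length xs}. weight l xs * c (set (take i xs)) * (l (last (take i xs)) - l (hd (drop i xs))) * P xs)
    = (\<Sum>xs\<in>permutations_of_set N. \<Sum>i\<in>{1..<length xs}.
        (\<lambda>ys zs. weight l (ys @ zs) * c (set ys) * (l (last ys) - l (hd zs)) * P (ys @ zs)) (take i xs) (drop i xs))"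
    by simp
  also have "\<dots> = (\<Sum>S\<in>Pow N - {{}, N}. \<Sum>ys\<in>permutations_of_set S. \<Sum>zs\<in>permutations_of_set (N - S).
       weight l (ys @ zs) * c (set ys) * (l (last ys) - l (hd zs)) * P (ys @ zs))"
    by (rule sum_permutations_cut[OF N(1)])
  also have "\<dots> = (\<Sum>S\<in>Pow N - {{}, N}. c S *
       (mixed_coeff l S {j \<in> K'. S \<inter> J j \<noteq> {}} J * mixed_coeff l (N - S) {j \<in> K'. S \<inter> J j = {}} J))"
  proof (rule sum.cong[OF refl])
    fix S assume S: "S \<in> Pow N - {{}, N}"
    \<comment> \<open>The first element of \<open>ys @ zs\<close> in \<open>J j\<close> lies in
      \<open>ys\<close> exactly when \<open>J j\<close> meets \<open>S\<close>; so each remaining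
      factor belongs to one block only, and the product splits.\<close>
    define A where "A = {j \<in> K'. S \<inter> J j \<noteq> {}}"
    define B where "B = {j \<in> K'. S \<inter> J j = {}}"
    have split: "P (ys @ zs) = (\<Prod>j\<in>A. hit l (J j) ys) * (\<Prod>j\<in>B. hit l (J j) zs)"
      if "set ys = S" for ys zs
    proof -
      have "P (ys @ zs) = (\<Prod>j\<in>A \<union> B. hit l (J j) (ys @ zs))"
        unfolding P_def A_def B_def by (intro prod.cong) auto
      also have "\<dots> = (\<Prod>j\<in>A. hit l (J j) (ys @ zs)) * (\<Prod>j\<in>B. hit l (J j) (ys @ zs))"
        using K' by (intro prod.union_disjoint) (auto simp: A_def B_def)
      also have "\<dots> = (\<Prod>j\<in>A. hit l (J j) ys) * (\<Prod>j\<in>B. hit l (J j) zs)"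
        using that by (simp add: A_def B_def hit_append)
      finally show ?thesis .
    qed
    have "(\<Sum>ys\<in>permutations_of_set S. \<Sum>zs\<in>permutations_of_set (N - S).
       weight l (ys @ zs) * c (set ys) * (l (last ys) - l (hd zs)) * P (ys @ zs)) =
       (\<Sum>ys\<in>permutations_of_set S. \<Sum>zs\<in>permutations_of_set (N - S).
         c S * ((weight l ys * (\<Prod>j\<in>A. hit l (J j) ys)) * (weight l zs * (\<Prod>j\<in>B. hit l (J j) zs))))"
    proof (intro sum.cong refl)
      fix ys zs assume ys: "ys \<in> permutations_of_set S" and zs: "zs \<in> permutations_of_set (N - S)"
      have ne: "ys \<noteq> []" "zs \<noteq> []" and s: "set ys = S" "set zs = N - S"
        using ys zs S by (auto simp: permutations_of_set_def)
      have "last ys \<in> S" "hd zs \<in> N - S" using ne s last_in_set hd_in_set by blast+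
      hence "last ys \<in> N" "hd zs \<in> N" "last ys \<noteq> hd zs" using S by auto
      hence "l (last ys) \<noteq> l (hd zs)" using N(2) by (simp add: inj_on_eq_iff)
      from weight_append[OF ne this] have "weight l (ys @ zs) * (l (last ys) - l (hd zs)) = weight l ys * weight l zs" .
      hence "c S * (weight l (ys @ zs) * (l (last ys) - l (hd zs))) * P (ys @ zs) = c S * (weight l ys * weight l zs) * P (ys @ zs)"
        by simp
      thus "weight l (ys @ zs) * c (set ys) * (l (last ys) - l (hd zs)) * P (ys @ zs) =
        c S * ((weight l ys * (\<Prod>j\<in>A. hit l (J j) ys)) * (weight l zs * (\<Prod>j\<in>B. hit l (J j) zs)))"
        using split[OF s(1), of zs] s by (simp add: mult_ac)
    qed
    also have "\<dots> = c S * (mixed_coeff l S A J * mixed_coeff l (N - S) B J)"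
      unfolding mixed_coeff_def
      by (simp only: sum_distrib_left[symmetric] sum_distrib_right[symmetric])
    finally show "(\<Sum>ys\<in>permutations_of_set S. \<Sum>zs\<in>permutations_of_set (N - S).
       weight l (ys @ zs) * c (set ys) * (l (last ys) - l (hd zs)) * P (ys @ zs)) =
       c S * (mixed_coeff l S {j \<in> K'. S \<inter> J j \<noteq> {}} J * mixed_coeff l (N - S) {j \<in> K'. S \<inter> J j = {}} J)"
      by (simp add: A_def B_def)
  qed
  finally show ?thesis by (simp add: K'_def c_def)
qed

section \<open>Vanishing below the critical number of factors\<close>

text \<open>With at least three elements, each cut leaves a block of size at least 2, so all cut
  terms vanish by induction. Expanding the coefficient of the single segment \<open>{a, b}\<close>
  at \<open>a\<close> and at \<open>b\<close> then gives
  \<open>l a * W N = l b * W N\<close>.\<close>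

lemma sum_weight_eq_0:
  assumes "finite N" "inj_on l N" "2 \<le> card N"
  shows "(\<Sum>xs\<in>permutations_of_set N. weight l xs) = 0"
  using assms
proof (induction N rule: finite_psubset_induct)
  case (psubset N)
  show ?case
  proof (cases "card N = 2")
    case True
    then obtain a b where N: "N = {a, b}" "a \<noteq> b" by (auto simp: card_2_iff)
    with psubset.prems have "l a \<noteq> l b" by (auto simp: inj_on_def)
    thus ?thesis using N by (simp add: permutations_of_set_doubleton field_simps)
  next
    case False
    define W where "W N = (\<Sum>xs\<in>permutations_of_set N. weight l xs)" for N
    have W: "mixed_coeff l N {} J = W N" for N and J :: "unit \<Rightarrow> 'a set"
      by (simp add: mixed_coeff_def W_def)
    have prod0: "W S * W (N - S) = 0" if S: "S \<in> Pow N - {{}, N}" for S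
    proof -
      have fS: "finite S" using S psubset.hyps finite_subset by auto
      have "card (N - S) = card N - card S" "card S < card N"
        using S fS psubset.hyps by (auto simp: card_Diff_subset intro!: psubset_card_mono)
      hence "2 \<le> card S \<or> 2 \<le> card (N - S)" using psubset.prems False by linarith
      moreover have "S \<subset> N" "N - S \<subset> N" "inj_on l S" "inj_on l (N - S)"
        using S psubset.prems by (auto intro: inj_on_subset)
      ultimately show ?thesis using psubset.IH[of S] psubset.IH[of "N - S"] by (auto simp: W_def)
    qed
    obtain a b where ab: "a \<in> N" "b \<in> N" "a \<noteq> b"
      using psubset.prems by (metis card_2_iff' obtain_subset_with_card_n subsetD)
    have *: "l v * W N = mixed_coeff l N {()} (\<lambda>_. {a, b})" if "v \<in> {a, b}" for v
    proof -
      have "mixed_coeff l N {()} (\<lambda>_. {a, b}) = l v * W N +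
        (\<Sum>S\<in>Pow N - {{}, N}. (of_bool (S \<inter> {a, b} \<noteq> {}) - of_bool (v \<in> S)) * (W S * W (N - S)))"
        using mixed_coeff_cut[of N l "{()}" "()" v "\<lambda>_. {a, b}"] psubset.hyps psubset.prems that ab
        by (auto simp: W)
      thus ?thesis using prod0 by simp
    qed
    have "(l a - l b) * W N = 0"
      unfolding left_diff_distrib *[of a, simplified] *[of b, simplified] by simp
    moreover have "l a \<noteq> l b" using ab psubset.prems by (auto simp: inj_on_def)
    ultimately show ?thesis by (simp add: W_def)
  qed
qed

lemma mixed_coeff_cong:
  assumes "\<And>k. k \<in> K \<Longrightarrow> J k \<inter> N = J' k \<inter> N"
  shows "mixed_coeff l N K J = mixed_coeff l N K J'"
  unfolding mixed_coeff_def
proof (intro sum.cong prod.cong refl arg_cong[of _ _ "\<lambda>x. _ * x"])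
  fix xs k assume "xs \<in> permutations_of_set N" "k \<in> K"
  thus "hit l (J k) xs = hit l (J' k) xs"
    using assms by (intro hit_cong) (auto simp: permutations_of_set_def)
qed

lemma mixed_coeff_disjoint:
  assumes "finite K" "k \<in> K" "J k \<inter> N = {}"
  shows "mixed_coeff l N K J = 0"
  unfolding mixed_coeff_def
proof (rule sum.neutral, rule ballI)
  fix xs assume "xs \<in> permutations_of_set N"
  hence "hit l (J k) xs = 0" using assms by (intro hit_disjoint) (auto simp: permutations_of_set_def)
  thus "weight l xs * (\<Prod>k\<in>K. hit l (J k) xs) = 0" using assms by (auto simp: prod_zero_iff)
qed

lemma cut_cards:
  fixes J :: "'k \<Rightarrow> 'a set"
  assumes "finite N" "finite K" "k \<in> K" "S \<in> Pow N - {{}, N}"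
    and A: "A = {j \<in> K - {k}. S \<inter> J j \<noteq> {}}" and B: "B = {j \<in> K - {k}. S \<inter> J j = {}}"
  shows "card A + card B + 1 = card K" "card S + card (N - S) = card N"
    "card S < card N" "card (N - S) < card N" "finite S" "finite A" "finite B"
proof -
  show f: "finite S" "finite A" "finite B" using assms finite_subset[of S N] by (auto simp: A B)
  have "K = insert k (A \<union> B)" "k \<notin> A \<union> B" using assms(3) by (auto simp: A B)
  moreover have "card (A \<union> B) = card A + card B"
    using f by (intro card_Un_disjoint) (auto simp: A B)
  ultimately show "card A + card B + 1 = card K" using f by simp
  show lt: "card S < card N" using assms by (intro psubset_card_mono) auto
  show "card S + card (N - S) = card N" using f lt assms by (simp add: card_Diff_subset)
  show "card (N - S) < card N" using assms by (intro psubset_card_mono) auto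
qed

text \<open>Expand at some \<open>k\<close>. The first term has one factor less; in a cut term the
  block sizes add up to \<open>card N\<close> but only \<open>card K - 1\<close> factors are
  distributed, so one of the blocks has too few again.\<close>

lemma mixed_coeff_eq_0:
  assumes "finite N" "inj_on l N" "finite K" "card K + 1 < card N"
  shows "mixed_coeff l N K J = 0"
  using assms
proof (induction "card N + card K" arbitrary: N K rule: less_induct)
  case less
  show ?case
  proof (cases "K = {}")
    case True
    thus ?thesis using sum_weight_eq_0[of N l] less.prems by (simp add: mixed_coeff_def)
  next
    case False
    then obtain k where k: "k \<in> K" by auto
    show ?thesis
    proof (cases "J k \<inter> N = {}")
      case True
      thus ?thesis using less.prems k by (intro mixed_coeff_disjoint)
    next
      case False
      then obtain v where v: "v \<in> J k" "v \<in> N" by auto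
      have 1: "mixed_coeff l N (K - {k}) J = 0"
      proof (rule less.hyps)
        show "card N + card (K - {k}) < card N + card K"
          using k less.prems card_Diff1_less[of K k] by simp
        show "card (K - {k}) + 1 < card N"
          using k less.prems by (simp add: card_Diff_singleton)
      qed (use less.prems in auto)
      have 2: "mixed_coeff l S {j \<in> K - {k}. S \<inter> J j \<noteq> {}} J *
          mixed_coeff l (N - S) {j \<in> K - {k}. S \<inter> J j = {}} J = 0" if S: "S \<in> Pow N - {{}, N}" for S
      proof -
        define A B where AB: "A = {j \<in> K - {k}. S \<inter> J j \<noteq> {}}" "B = {j \<in> K - {k}. S \<inter> J j = {}}"
        note c = cut_cards[OF less.prems(1,3) k S AB]
        have "card A + 1 < card S \<or> card B + 1 < card (N - S)" using c less.prems by linarith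
        hence "mixed_coeff l S A J = 0 \<or> mixed_coeff l (N - S) B J = 0"
        proof
          assume "card A + 1 < card S"
          thus ?thesis using c S less.prems
            by (intro disjI1 less.hyps) (auto intro: inj_on_subset)
        next
          assume "card B + 1 < card (N - S)"
          thus ?thesis using c S less.prems
            by (intro disjI2 less.hyps) (auto intro: inj_on_subset)
        qed
        thus ?thesis by (auto simp: AB)
      qed
      show ?thesis
        unfolding mixed_coeff_cut[where J = J, OF less.prems(1,2,3) k v] 1 mult_zero_right add_0_left
        by (intro sum.neutral ballI) (simp only: 2 mult_zero_right)
    qed
  qed
qed

text \<open>At the critical size the term with the explicit factor \<open>l v\<close> has too few
  factors and vanishes. What is left mentions \<open>l\<close> only inside smaller
  coefficients.\<close>

lemma mixed_coeff_rec:
  assumes N: "finite N" "inj_on l N" and K: "finite K" "card K + 1 = card N" "k \<in> K"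
    and v: "v \<in> J k" "v \<in> N"
  shows "mixed_coeff l N K J =
    (\<Sum>S\<in>Pow N - {{}, N}. (of_bool (S \<inter> J k \<noteq> {}) - of_bool (v \<in> S)) *
       (mixed_coeff l S {j \<in> K - {k}. S \<inter> J j \<noteq> {}} J *
        mixed_coeff l (N - S) {j \<in> K - {k}. S \<inter> J j = {}} J))"
proof -
  have "card (K - {k}) + 1 < card N"
    using K by (metis Suc_eq_plus1 card.remove less_add_one)
  hence "mixed_coeff l N (K - {k}) J = 0" using N K by (intro mixed_coeff_eq_0) auto
  thus ?thesis using mixed_coeff_cut[where J = J, OF N K(1,3) v] by simp
qed

text \<open>Either one block has too few factors and kills the product, or both blocks are of
  critical size and induction applies to them.\<close>

lemma mixed_coeff_cut_cases:
  fixes J :: "'k \<Rightarrow> 'a set"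
  assumes N: "finite N" "inj_on l N" and K: "finite K" "card K + 1 = card N" "k \<in> K"
    and S: "S \<in> Pow N - {{}, N}"
    and A: "A = {j \<in> K - {k}. S \<inter> J j \<noteq> {}}" and B: "B = {j \<in> K - {k}. S \<inter> J j = {}}"
  shows "mixed_coeff l S A J * mixed_coeff l (N - S) B J = 0 \<or>
    card A + 1 = card S \<and> card B + 1 = card (N - S)"
proof -
  note c = cut_cards[OF N(1) K(1,3) S A B]
  have inj: "inj_on l S" "inj_on l (N - S)" "finite (N - S)" using N S by (auto intro: inj_on_subset)
  consider "card A + 1 < card S" | "card B + 1 < card (N - S)"
    | "card A + 1 = card S" "card B + 1 = card (N - S)"
    using c K(2) by linarith
  thus ?thesis
    by cases (use mixed_coeff_eq_0[of S l A J] mixed_coeff_eq_0[of "N - S" l B J] inj c in auto)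
qed

section \<open>Positivity and monotonicity\<close>

text \<open>Since \<open>v\<close> is chosen in \<open>J k\<close>, a set containing
  \<open>v\<close> meets \<open>J k\<close>, so the difference of indicators in the recursion is
  nonnegative.\<close>

lemma mixed_coeff_nonneg:
  assumes "finite N" "inj_on l N" "finite K" "card K + 1 = card N"
  shows "0 \<le> mixed_coeff l N K J"
  using assms
proof (induction "card N" arbitrary: N K rule: less_induct)
  case less
  show ?case
  proof (cases "K = {}")
    case True
    hence "card N = 1" using less.prems by simp
    then obtain a where "N = {a}" by (auto simp: card_1_singleton_iff)
    thus ?thesis using True by (simp add: mixed_coeff_def)
  next
    case False
    then obtain k where k: "k \<in> K" by auto
    show ?thesis
    proof (cases "J k \<inter> N = {}")
      case True
      thus ?thesis using mixed_coeff_disjoint[of K k J N l] less.prems k by simp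
    next
      case False
      then obtain v where v: "v \<in> J k" "v \<in> N" by auto
      show ?thesis unfolding mixed_coeff_rec[where J = J, OF less.prems k v]
      proof (rule sum_nonneg, rule mult_nonneg_nonneg)
        fix S assume S: "S \<in> Pow N - {{}, N}"
        define A B where AB: "A = {j \<in> K - {k}. S \<inter> J j \<noteq> {}}" "B = {j \<in> K - {k}. S \<inter> J j = {}}"
        note c = cut_cards[OF less.prems(1,3) k S AB]
        have *: "mixed_coeff l S A J * mixed_coeff l (N - S) B J \<ge> 0"
          using mixed_coeff_cut_cases[OF less.prems k S AB]
        proof
          assume cd: "card A + 1 = card S \<and> card B + 1 = card (N - S)"
          have "mixed_coeff l S A J \<ge> 0" "mixed_coeff l (N - S) B J \<ge> 0"
            by (rule less.hyps; use cd c S less.prems in \<open>auto intro: inj_on_subset\<close>)+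
          thus ?thesis by simp
        qed (simp only: order_refl)
        show "mixed_coeff l S {j \<in> K - {k}. S \<inter> J j \<noteq> {}} J *
          mixed_coeff l (N - S) {j \<in> K - {k}. S \<inter> J j = {}} J \<ge> 0" using * by (simp add: AB)
      qed (use v in auto)
    qed
  qed
qed

lemma mixed_coeff_cut_nonneg:
  assumes N: "finite N" "inj_on l N" and K: "finite K" "card K + 1 = card N" "k \<in> K"
    and S: "S \<in> Pow N - {{}, N}"
  shows "0 \<le> mixed_coeff l S {j \<in> K - {k}. S \<inter> J j \<noteq> {}} J *
    mixed_coeff l (N - S) {j \<in> K - {k}. S \<inter> J j = {}} J"
proof -
  define A B where AB: "A = {j \<in> K - {k}. S \<inter> J j \<noteq> {}}" "B = {j \<in> K - {k}. S \<inter> J j = {}}"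
  note c = cut_cards[OF N(1) K(1,3) S AB]
  have "mixed_coeff l S A J * mixed_coeff l (N - S) B J \<ge> 0"
    using mixed_coeff_cut_cases[OF N K S AB]
  proof
    assume cd: "card A + 1 = card S \<and> card B + 1 = card (N - S)"
    have "mixed_coeff l S A J \<ge> 0" "mixed_coeff l (N - S) B J \<ge> 0"
      by (rule mixed_coeff_nonneg; use cd c S N in \<open>auto intro: inj_on_subset\<close>)+
    thus ?thesis by simp
  qed (simp only: order_refl)
  thus ?thesis by (simp add: AB)
qed

text \<open>Expand both sides at \<open>k\<close> with the same \<open>v\<close> in
  \<open>J k\<close>. The index \<open>k\<close> is absent from both blocks, so enlarging
  \<open>J k\<close> affects only the indicator of \<open>S \<inter> J k \<noteq> {}\<close>, which
  can only grow.\<close>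

lemma mixed_coeff_mono1:
  assumes "finite N" "inj_on l N" "finite K" "card K + 1 = card N" "k \<in> K" "J k \<subseteq> M"
  shows "mixed_coeff l N K J \<le> mixed_coeff l N K (J(k := M))"
proof (cases "J k \<inter> N = {}")
  case True
  thus ?thesis using mixed_coeff_disjoint[of K k J N l] mixed_coeff_nonneg[OF assms(1-4)] assms by simp
next
  case False
  then obtain v where v: "v \<in> J k" "v \<in> N" by auto
  have v': "v \<in> (J(k := M)) k" using v assms by auto
  let ?J = "J(k := M)"
  have cong: "mixed_coeff l T {j \<in> K - {k}. P (?J j)} ?J = mixed_coeff l T {j \<in> K - {k}. P (J j)} J" for T P
  proof -
    have *: "{j \<in> K - {k}. P (?J j)} = {j \<in> K - {k}. P (J j)}" by auto
    show ?thesis unfolding * by (rule mixed_coeff_cong) simp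
  qed
  show ?thesis
    unfolding mixed_coeff_rec[where J = J, OF assms(1-5) v] mixed_coeff_rec[where J = ?J, OF assms(1-5) v' v(2)]
      cong[of _ "\<lambda>X. _ \<inter> X = {}"] cong[of _ "\<lambda>X. _ \<inter> X \<noteq> {}"]
  proof (intro sum_mono mult_right_mono)
    fix S assume "S \<in> Pow N - {{}, N}"
    thus "mixed_coeff l S {j \<in> K - {k}. S \<inter> J j \<noteq> {}} J *
      mixed_coeff l (N - S) {j \<in> K - {k}. S \<inter> J j = {}} J \<ge> 0"
      by (rule mixed_coeff_cut_nonneg[OF assms(1-5)])
  qed (use assms(6) in auto)
qed

lemma mixed_coeff_mono:
  assumes "finite N" "inj_on l N" "finite K" "card K + 1 = card N" "\<And>k. k \<in> K \<Longrightarrow> J k \<subseteq> J' k"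
  shows "mixed_coeff l N K J \<le> mixed_coeff l N K J'"
proof -
  have "mixed_coeff l N K J \<le> mixed_coeff l N K (\<lambda>k. if k \<in> F then J' k else J k)" if "F \<subseteq> K" "finite F" for F
    using that(2,1)
  proof induction
    case (insert k F)
    let ?J = "\<lambda>k. if k \<in> F then J' k else J k"
    have "mixed_coeff l N K ?J \<le> mixed_coeff l N K (?J(k := J' k))"
      using assms insert by (intro mixed_coeff_mono1) auto
    also have "?J(k := J' k) = (\<lambda>j. if j \<in> insert k F then J' j else J j)"
      by (rule ext) simp
    finally show ?case using insert by simp
  qed simp
  from this[of K] have "mixed_coeff l N K J \<le> mixed_coeff l N K (\<lambda>k. if k \<in> K then J' k else J k)"
    using assms by simp
  also have "\<dots> = mixed_coeff l N K J'" by (rule mixed_coeff_cong) simp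
  finally show ?thesis .
qed

section \<open>Extremal families: full simplices, segments, deficient families\<close>

text \<open>Every nonempty \<open>S\<close> meets \<open>N\<close>, so the second block gets no
  factors and must be a singleton. As it contains \<open>v\<close> whenever the cut has nonzero
  coefficient, only \<open>S = N - {v}\<close> contributes.\<close>

lemma mixed_coeff_full:
  assumes "finite N" "inj_on l N" "finite K" "card K + 1 = card N"
  shows "mixed_coeff l N K (\<lambda>_. N) = 1"
  using assms
proof (induction "card N" arbitrary: N K rule: less_induct)
  case less
  show ?case
  proof (cases "K = {}")
    case True
    hence "card N = 1" using less.prems by simp
    then obtain a where "N = {a}" by (auto simp: card_1_singleton_iff)
    thus ?thesis using True by (simp add: mixed_coeff_def)
  next
    case False
    then obtain k where k: "k \<in> K" by auto
    have "N \<noteq> {}" using less.prems by auto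
    then obtain v where v: "v \<in> N" by auto
    have cK: "card (K - {k}) + 1 = card K" using k less.prems by (metis Suc_eq_plus1 card.remove)
    have *: "(of_bool (S \<inter> N \<noteq> {}) - of_bool (v \<in> S)) *
       (mixed_coeff l S {j \<in> K - {k}. S \<inter> N \<noteq> {}} (\<lambda>_. N) *
        mixed_coeff l (N - S) {j \<in> K - {k}. S \<inter> N = {}} (\<lambda>_. N)) = (if S = N - {v} then 1 else 0)"
      if S: "S \<in> Pow N - {{}, N}" for S
    proof (cases "v \<in> S")
      case True
      thus ?thesis using v by auto
    next
      case False
      have SN: "S \<inter> N \<noteq> {}" using S by auto
      have emp: "{j \<in> K - {k}. S \<inter> N = {}} = {}" and full: "{j \<in> K - {k}. S \<inter> N \<noteq> {}} = K - {k}"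
        using SN by auto
      show ?thesis
      proof (cases "S = N - {v}")
        case True
        have NS: "N - S = {v}" using True v by auto
        have "mixed_coeff l S (K - {k}) (\<lambda>_. N) = mixed_coeff l S (K - {k}) (\<lambda>_. S)"
          using S by (intro mixed_coeff_cong) auto
        also have "\<dots> = 1"
        proof (rule less.hyps)
          show "card S < card N" using S less.prems by (intro psubset_card_mono) auto
          show "card (K - {k}) + 1 = card S" using cK less.prems True v by simp
        qed (use S less.prems in \<open>auto intro: inj_on_subset finite_subset\<close>)
        finally show ?thesis using True False SN unfolding emp full NS by (simp add: mixed_coeff_def)
      next
        case neq: False
        have "N - S \<noteq> {v}" using neq S v by auto
        hence "card (N - S) \<noteq> 1" using v False by (metis DiffI card_1_singletonE singletonD)
        moreover have "N - S \<noteq> {}" using S by blast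
        hence "card (N - S) \<noteq> 0" using less.prems by simp
        ultimately have "card ({} :: 'b set) + 1 < card (N - S)" by simp
        hence "mixed_coeff l (N - S) ({} :: 'b set) (\<lambda>_. N) = 0"
          using less.prems by (intro mixed_coeff_eq_0) (auto intro: inj_on_subset)
        thus ?thesis using neq unfolding emp by simp
      qed
    qed
    have "mixed_coeff l N K (\<lambda>_. N) = (\<Sum>S\<in>Pow N - {{}, N}. if S = N - {v} then 1 else 0)"
      unfolding mixed_coeff_rec[of N l K k v "\<lambda>_. N", OF less.prems k v v] using * by (intro sum.cong) auto
    also have "\<dots> = 1"
    proof -
      have "N - {v} \<noteq> {}" using False less.prems cK v k
        by (metis card_0_eq card.infinite card_Diff_singleton diff_add_inverse2)
      hence "N - {v} \<in> Pow N - {{}, N}" using v by auto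
      thus ?thesis using less.prems by (simp add: sum.delta)
    qed
    finally show ?thesis .
  qed
qed

text \<open>All terms of the recursion are nonnegative, so a single one gives the bound: the cut at
  \<open>{e k}\<close> splits off a leaf and leaves a smaller star with the same centre
  \<open>v\<close>.\<close>

lemma mixed_coeff_star:
  assumes "finite N" "inj_on l N" "finite K" "v \<in> N" "bij_betw e K (N - {v})"
  shows "1 \<le> mixed_coeff l N K (\<lambda>k. {v, e k})"
  using assms
proof (induction "card N" arbitrary: N K rule: less_induct)
  case less
  let ?J = "\<lambda>k. {v, e k}"
  have cK: "card K + 1 = card N" using bij_betw_same_card[OF less.prems(5)] less.prems
    by (metis Suc_eq_plus1 card.remove)
  show ?case
  proof (cases "K = {}")
    case True
    hence "N = {v}" using less.prems by (auto simp: bij_betw_def)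
    thus ?thesis using True by (simp add: mixed_coeff_def)
  next
    case False
    then obtain k where k: "k \<in> K" by auto
    have ek: "e k \<in> N" "e k \<noteq> v" using less.prems k by (auto simp: bij_betw_def)
    let ?f = "\<lambda>S. (of_bool (S \<inter> {v, e k} \<noteq> {}) - of_bool (v \<in> S)) *
       (mixed_coeff l S {j \<in> K - {k}. S \<inter> {v, e j} \<noteq> {}} ?J *
        mixed_coeff l (N - S) {j \<in> K - {k}. S \<inter> {v, e j} = {}} ?J)"
    have nonneg: "?f S \<ge> 0" if S: "S \<in> Pow N - {{}, N}" for S
    proof (rule mult_nonneg_nonneg)
      show "mixed_coeff l S {j \<in> K - {k}. S \<inter> {v, e j} \<noteq> {}} ?J *
        mixed_coeff l (N - S) {j \<in> K - {k}. S \<inter> {v, e j} = {}} ?J \<ge> 0"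
        by (rule mixed_coeff_cut_nonneg[OF less.prems(1-3) cK k S])
    qed auto
    have S: "{e k} \<in> Pow N - {{}, N}" using ek less.prems by auto
    have "1 \<le> ?f {e k}"
    proof -
      have ne: "e j \<noteq> e k" if "j \<in> K - {k}" for j
        using that k less.prems by (auto simp: bij_betw_def inj_on_def)
      have sets: "{j \<in> K - {k}. {e k} \<inter> {v, e j} \<noteq> {}} = {}"
        "{j \<in> K - {k}. {e k} \<inter> {v, e j} = {}} = K - {k}"
        using ne ek by auto
      have "1 \<le> mixed_coeff l (N - {e k}) (K - {k}) ?J"
      proof (rule less.hyps)
        show "card (N - {e k}) < card N" using ek less.prems by (meson card_Diff1_less)
        have e: "inj_on e K" "e ` K = N - {v}" using less.prems(5) by (simp_all add: bij_betw_def)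
        have "e ` (K - {k}) = e ` K - e ` {k}"
          by (rule inj_on_image_set_diff[OF e(1)]) (use k in auto)
        also have "\<dots> = N - {v} - {e k}" by (simp only: e(2) image_insert image_empty)
        also have "\<dots> = N - {e k} - {v}" by blast
        finally show "bij_betw e (K - {k}) (N - {e k} - {v})"
          by (intro bij_betw_subset[OF less.prems(5)]) simp_all
      qed (use less.prems ek in \<open>auto intro: inj_on_subset\<close>)
      thus ?thesis using ek unfolding sets by (simp add: mixed_coeff_def)
    qed
    also have "?f {e k} \<le> (\<Sum>S\<in>Pow N - {{}, N}. ?f S)"
      using nonneg S less.prems by (intro member_le_sum) auto
    also have "\<dots> = mixed_coeff l N K ?J"
      using mixed_coeff_rec[of N l K k v ?J, OF less.prems(1-3) cK k] less.prems by simp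
    finally show ?thesis .
  qed
qed

text \<open>Expand at a member \<open>k\<close> of \<open>Q\<close>. The other members are shared
  between the two blocks, and so is the union \<open>U\<close>; since \<open>k\<close> itself is
  gone, a count shows that one of the blocks inherits a deficient subfamily.\<close>

lemma mixed_coeff_deficient:
  assumes "finite N" "inj_on l N" "finite K" "card K + 1 = card N"
    and "Q \<subseteq> K" "Q \<noteq> {}" "card (N \<inter> (\<Union>j\<in>Q. J j)) \<le> card Q"
  shows "mixed_coeff l N K J = 0"
  using assms
proof (induction "card N" arbitrary: N K Q rule: less_induct)
  case less
  from less.prems obtain k where k: "k \<in> Q" "k \<in> K" by auto
  define U where "U = (\<Union>j\<in>Q. J j)"
  have fQ: "finite Q" using less.prems finite_subset by blast
  show ?case
  proof (cases "J k \<inter> N = {}")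
    case True
    thus ?thesis using mixed_coeff_disjoint[of K k J N l] less.prems k by simp
  next
    case False
    then obtain v where v: "v \<in> J k" "v \<in> N" by auto
    show ?thesis unfolding mixed_coeff_rec[where J = J, OF less.prems(1-4) k(2) v]
    proof (rule sum.neutral, rule ballI)
      fix S assume S: "S \<in> Pow N - {{}, N}"
      define A B where AB: "A = {j \<in> K - {k}. S \<inter> J j \<noteq> {}}" "B = {j \<in> K - {k}. S \<inter> J j = {}}"
      note c = cut_cards[OF less.prems(1,3) k(2) S AB]
      have "mixed_coeff l S A J * mixed_coeff l (N - S) B J = 0"
        if coef: "S \<inter> J k \<noteq> {}" "v \<notin> S"
        using mixed_coeff_cut_cases[OF less.prems(1-4) k(2) S AB]
      proof
        assume cd: "card A + 1 = card S \<and> card B + 1 = card (N - S)"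
        define QA QB where Q: "QA = Q \<inter> A" "QB = Q \<inter> B"
        have "Q = insert k (QA \<union> QB)" "k \<notin> QA \<union> QB" "QA \<inter> QB = {}"
          using k less.prems by (auto simp: Q AB)
        moreover have fin: "finite QA" "finite QB" using fQ Q by auto
        ultimately have cQ: "card Q = card QA + card QB + 1" by (simp add: card_Un_disjoint)
        have "card (N \<inter> U) = card (S \<inter> U \<union> (N - S) \<inter> U)" using S by (intro arg_cong[of _ _ card]) auto
        also have "\<dots> = card (S \<inter> U) + card ((N - S) \<inter> U)"
          using c less.prems by (intro card_Un_disjoint) auto
        finally have sum: "card (S \<inter> U) + card ((N - S) \<inter> U) \<le> card QA + card QB + 1"
          using less.prems(7) cQ by (simp add: U_def)
        \<comment> \<open>\<open>S\<close> meets \<open>J k\<close>, and \<open>N - S\<close>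
          contains \<open>v\<close>. This guarantees that the deficient subfamily found in a block
          is nonempty.\<close>
        have pos: "card (S \<inter> U) > 0" "card ((N - S) \<inter> U) > 0"
          using coef v k c less.prems by (auto simp: card_gt_0_iff U_def)
        have "mixed_coeff l S A J = 0 \<or> mixed_coeff l (N - S) B J = 0"
        proof (cases "card (S \<inter> U) \<le> card QA")
          case True
          have "mixed_coeff l S A J = 0"
          proof (rule less.hyps)
            show "QA \<subseteq> A" "QA \<noteq> {}" using True pos by (auto simp: Q)
            have "card (S \<inter> (\<Union>j\<in>QA. J j)) \<le> card (S \<inter> U)"
              using c by (intro card_mono) (auto simp: U_def Q)
            thus "card (S \<inter> (\<Union>j\<in>QA. J j)) \<le> card QA" using True by simp
          qed (use c cd S less.prems in \<open>auto intro: inj_on_subset\<close>)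
          thus ?thesis ..
        next
          case False
          hence le: "card ((N - S) \<inter> U) \<le> card QB" using sum by linarith
          have "mixed_coeff l (N - S) B J = 0"
          proof (rule less.hyps)
            show "QB \<subseteq> B" "QB \<noteq> {}" using le pos by (auto simp: Q)
            have "card ((N - S) \<inter> (\<Union>j\<in>QB. J j)) \<le> card ((N - S) \<inter> U)"
              using less.prems by (intro card_mono) (auto simp: U_def Q)
            thus "card ((N - S) \<inter> (\<Union>j\<in>QB. J j)) \<le> card QB" using le by simp
          qed (use c cd S less.prems in \<open>auto intro: inj_on_subset\<close>)
          thus ?thesis ..
        qed
        thus ?thesis by simp
      qed
      thus "(of_bool (S \<inter> J k \<noteq> {}) - of_bool (v \<in> S)) *
       (mixed_coeff l S {j \<in> K - {k}. S \<inter> J j \<noteq> {}} J *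
        mixed_coeff l (N - S) {j \<in> K - {k}. S \<inter> J j = {}} J) = 0"
        using v by (auto simp: AB)
    qed
  qed
qed

section \<open>Hall's theorem and the values 0 and 1\<close>

text \<open>If some proper nonempty \<open>Q\<close> is tight, \<open>Q\<close> is matched by itself
  and the rest outside \<open>U\<close>, where Hall's condition survives. If none is tight, every
  proper nonempty subfamily has a surplus of one, and any \<open>x\<close> in \<open>I k\<close> may
  be given to \<open>k\<close>.\<close>

lemma hall_marriage:
  fixes I :: "'k \<Rightarrow> 'a set"
  assumes "finite K" "\<And>k. k \<in> K \<Longrightarrow> finite (I k)"
    and "\<And>Q. Q \<subseteq> K \<Longrightarrow> card Q \<le> card (\<Union>k\<in>Q. I k)"
  shows "\<exists>e. inj_on e K \<and> (\<forall>k\<in>K. e k \<in> I k)"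
  using assms
proof (induction "card K" arbitrary: K I rule: less_induct)
  case less
  note fin = less.prems(1) and finI = less.prems(2) and hall = less.prems(3)
  show ?case
  proof (cases "K = {}")
    case False
    then obtain k where k: "k \<in> K" by auto
    show ?thesis
    proof (cases "\<exists>Q. Q \<subset> K \<and> Q \<noteq> {} \<and> card (\<Union>k\<in>Q. I k) = card Q")
      case True
      then obtain Q where Q: "Q \<subset> K" "Q \<noteq> {}" "card (\<Union>k\<in>Q. I k) = card Q" by auto
      define U where "U = (\<Union>k\<in>Q. I k)"
      have fQ: "finite Q" using Q(1) fin finite_subset by auto
      have fU: "finite U" using fQ Q(1) finI by (auto simp: U_def)
      have "\<exists>e. inj_on e Q \<and> (\<forall>k\<in>Q. e k \<in> I k)"
      proof (rule less.hyps)
        show "card Q < card K" using Q(1) fin by (simp add: psubset_card_mono)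
      qed (use fQ finI Q(1) hall in auto)
      then obtain e1 where e1: "inj_on e1 Q" "\<And>k. k \<in> Q \<Longrightarrow> e1 k \<in> I k" by auto
      have "\<exists>e. inj_on e (K - Q) \<and> (\<forall>k\<in>K - Q. e k \<in> I k - U)"
      proof (rule less.hyps)
        show "card (K - Q) < card K" using Q fin by (intro psubset_card_mono) auto
      next
        fix R assume R: "R \<subseteq> K - Q"
        have fR: "finite R" using R fin finite_subset by blast
        have fRI: "finite (\<Union>k\<in>R. I k - U)" using fR R finI by auto
        have "card R + card Q = card (R \<union> Q)" using R fR fQ by (subst card_Un_disjoint) auto
        also have "\<dots> \<le> card (\<Union>k\<in>R \<union> Q. I k)" using R Q by (intro hall) auto
        also have "(\<Union>k\<in>R \<union> Q. I k) = (\<Union>k\<in>R. I k - U) \<union> U" by (auto simp: U_def)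
        also have "card \<dots> = card (\<Union>k\<in>R. I k - U) + card U"
          using fRI fU by (intro card_Un_disjoint) auto
        finally show "card R \<le> card (\<Union>k\<in>R. I k - U)" using Q(3) by (simp add: U_def)
      qed (use fin finI in auto)
      then obtain e2 where e2: "inj_on e2 (K - Q)" "\<And>k. k \<in> K - Q \<Longrightarrow> e2 k \<in> I k - U" by auto
      define e where "e k = (if k \<in> Q then e1 k else e2 k)" for k
      have ne: "e1 i \<noteq> e2 j" if "i \<in> Q" "j \<in> K - Q" for i j
      proof -
        have "e1 i \<in> U" using e1(2)[OF that(1)] that(1) by (auto simp: U_def)
        thus ?thesis using e2(2)[OF that(2)] by auto
      qed
      have "inj_on e K"
      proof (rule inj_onI)
        fix i j assume ij: "i \<in> K" "j \<in> K" "e i = e j"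
        show "i = j"
          using ij ne[of i j] ne[of j i] inj_onD[OF e1(1), of i j] inj_onD[OF e2(1), of i j]
          by (cases "i \<in> Q"; cases "j \<in> Q") (simp_all add: e_def)
      qed
      moreover have "\<forall>k\<in>K. e k \<in> I k" using e1(2) e2(2) by (auto simp: e_def)
      ultimately show ?thesis by blast
    next
      case notight: False
      have "card {k} \<le> card (\<Union>k\<in>{k}. I k)" using k by (intro hall) auto
      then obtain x where x: "x \<in> I k" by fastforce
      have "\<exists>e. inj_on e (K - {k}) \<and> (\<forall>j\<in>K - {k}. e j \<in> I j - {x})"
      proof (rule less.hyps)
        show "card (K - {k}) < card K" using k fin by (rule card_Diff1_less[rotated])
      next
        fix Q assume Q: "Q \<subseteq> K - {k}"
        show "card Q \<le> card (\<Union>j\<in>Q. I j - {x})"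
        proof (cases "Q = {}")
          case False
          have "Q \<subset> K" using Q k by auto
          hence "card (\<Union>j\<in>Q. I j) \<noteq> card Q" using notight False by blast
          moreover have "card Q \<le> card (\<Union>j\<in>Q. I j)" using \<open>Q \<subset> K\<close> by (intro hall) auto
          ultimately have "card Q \<le> card (\<Union>j\<in>Q. I j) - 1" by linarith
          also have "\<dots> \<le> card ((\<Union>j\<in>Q. I j) - {x})" by (simp add: card_Diff_singleton_if)
          also have "(\<Union>j\<in>Q. I j) - {x} = (\<Union>j\<in>Q. I j - {x})" by auto
          finally show ?thesis .
        qed simp
      qed (use fin finI in auto)
      then obtain e where e: "inj_on e (K - {k})" "\<And>j. j \<in> K - {k} \<Longrightarrow> e j \<in> I j - {x}" by auto
      have "inj_on (e(k := x)) (insert k (K - {k}))"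
        using e by (subst inj_on_insert) (auto simp: inj_on_def)
      hence "inj_on (e(k := x)) K" using k by (simp add: insert_absorb)
      moreover have "\<forall>j\<in>K. (e(k := x)) j \<in> I j" using e x by auto
      ultimately show ?thesis by blast
    qed
  qed auto
qed

text \<open>Distinct representatives \<open>e k\<close> exhaust \<open>N - {v}\<close>, and
  monotonicity squeezes the coefficient between the star of segments \<open>{v, e k}\<close> and the
  family of full simplices.\<close>

lemma mixed_coeff_hall:
  assumes N: "finite N" "inj_on l N" and K: "finite K" "card K + 1 = card N"
    and v: "v \<in> N" "\<And>k. k \<in> K \<Longrightarrow> v \<in> J k" and J: "\<And>k. k \<in> K \<Longrightarrow> J k \<subseteq> N"
  shows "mixed_coeff l N K J = (if \<forall>Q\<subseteq>K. card Q \<le> card (\<Union>k\<in>Q. J k - {v}) then 1 else 0)"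
proof (cases "\<forall>Q\<subseteq>K. card Q \<le> card (\<Union>k\<in>Q. J k - {v})")
  case True
  have "\<exists>e. inj_on e K \<and> (\<forall>k\<in>K. e k \<in> J k - {v})"
    using True K J N by (intro hall_marriage) (auto dest: finite_subset)
  then obtain e where e: "inj_on e K" "\<And>k. k \<in> K \<Longrightarrow> e k \<in> J k - {v}" by auto
  have "e ` K = N - {v}"
  proof (rule card_subset_eq)
    show "e ` K \<subseteq> N - {v}" using e J by auto
    show "card (e ` K) = card (N - {v})" using e K v N by (simp add: card_image)
  qed (use N in auto)
  hence "1 \<le> mixed_coeff l N K (\<lambda>k. {v, e k})"
    using N K v e by (intro mixed_coeff_star) (auto simp: bij_betw_def)
  also have "\<dots> \<le> mixed_coeff l N K J"
    using e v by (intro mixed_coeff_mono N K) auto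
  finally have "1 \<le> mixed_coeff l N K J" .
  moreover have "mixed_coeff l N K J \<le> mixed_coeff l N K (\<lambda>_. N)"
    using J by (intro mixed_coeff_mono N K)
  moreover have "\<dots> = 1" by (intro mixed_coeff_full N K)
  ultimately show ?thesis using True by auto
next
  case False
  then obtain Q where Q: "Q \<subseteq> K" "card (\<Union>k\<in>Q. J k - {v}) < card Q" by (auto simp: not_le)
  define X where "X = (\<Union>k\<in>Q. J k - {v})"
  have fin: "finite X"
    unfolding X_def using Q(1) J by (intro finite_subset[OF _ N(1)]) blast
  \<comment> \<open>Putting the common vertex \<open>v\<close> back costs at most one element, which
    the strict failure of Hall's condition absorbs.\<close>
  have "N \<inter> (\<Union>k\<in>Q. J k) \<subseteq> insert v X" by (auto simp: X_def)
  hence "card (N \<inter> (\<Union>k\<in>Q. J k)) \<le> card (insert v X)"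
    using fin by (intro card_mono) auto
  also have "\<dots> \<le> card Q" using Q(2)[folded X_def] fin by (simp add: card_insert_if)
  finally have le: "card (N \<inter> (\<Union>k\<in>Q. J k)) \<le> card Q" .
  have "Q \<noteq> {}" using Q(2) by auto
  hence "mixed_coeff l N K J = 0" by (intro mixed_coeff_deficient[OF N K Q(1) _ le])
  thus ?thesis by (simp only: if_not_P[OF False])
qed

section \<open>Multinomial expansion\<close>

definition compositions :: "'k set \<Rightarrow> nat \<Rightarrow> ('k \<Rightarrow> nat) set" where
  "compositions M n = {a \<in> M \<rightarrow>\<^sub>E UNIV. sum a M = n}"

lemma finite_compositions:
  assumes "finite M" shows "finite (compositions M n)"
proof (rule finite_subset)
  show "compositions M n \<subseteq> M \<rightarrow>\<^sub>E {..n}"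
  proof
    fix a assume a: "a \<in> compositions M n"
    hence "a i \<le> n" if "i \<in> M" for i
      using assms that member_le_sum[of i M a] by (simp add: compositions_def)
    thus "a \<in> M \<rightarrow>\<^sub>E {..n}" using a by (simp add: compositions_def PiE_iff)
  qed
qed (use assms in \<open>auto intro: finite_PiE\<close>)

text \<open>The factorials are attached to the single powers because that is the shape of the terms
  in the final volume formula. Induction splits off one variable by the binomial theorem.\<close>

lemma multinomial_theorem:
  fixes x :: "'k \<Rightarrow> real"
  assumes "finite M"
  shows "sum x M ^ n = fact n * (\<Sum>a\<in>compositions M n. \<Prod>k\<in>M. x k ^ a k / fact (a k))"
  using assms
proof (induction M arbitrary: n)
  case empty
  have *: "compositions {} n = (if n = 0 then {\<lambda>_. undefined} else {})" by (auto simp: compositions_def)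
  show ?case unfolding * by simp
next
  case (insert k M)
  let ?P = "\<lambda>M a. \<Prod>k\<in>M. x k ^ a k / fact (a k)"
  have "sum x (insert k M) ^ n = (\<Sum>i\<le>n. real (n choose i) * x k ^ i * sum x M ^ (n - i))"
    using insert.hyps by (simp add: binomial_ring)
  also have "\<dots> = (\<Sum>i\<le>n. fact n * (x k ^ i / fact i * (\<Sum>a\<in>compositions M (n - i). ?P M a)))"
  proof (rule sum.cong[OF refl])
    fix i assume "i \<in> {..n}"
    thus "real (n choose i) * x k ^ i * sum x M ^ (n - i)
      = fact n * (x k ^ i / fact i * (\<Sum>a\<in>compositions M (n - i). ?P M a))"
      unfolding insert.IH by (simp add: binomial_fact)
  qed
  also have "\<dots> = fact n * (\<Sum>i\<le>n. \<Sum>a\<in>compositions M (n - i). x k ^ i / fact i * ?P M a)"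
    by (simp only: sum_distrib_left)
  also have "(\<Sum>i\<le>n. \<Sum>a\<in>compositions M (n - i). x k ^ i / fact i * ?P M a) =
     (\<Sum>(i, a)\<in>(SIGMA i:{..n}. compositions M (n - i)). x k ^ i / fact i * ?P M a)"
    by (rule sum.Sigma) (use insert.hyps in \<open>auto intro: finite_compositions\<close>)
  also have "\<dots> = (\<Sum>a\<in>compositions (insert k M) n. ?P (insert k M) a)"
  proof (rule sum.reindex_bij_witness[where j = "\<lambda>(i, a). a(k := i)" and i = "\<lambda>a. (a k, a(k := undefined))"])
    fix p assume p: "p \<in> (SIGMA i:{..n}. compositions M (n - i))"
    obtain i a where ia: "p = (i, a)" by (cases p)
    have a: "i \<le> n" "a \<in> M \<rightarrow>\<^sub>E UNIV" "sum a M = n - i" using p by (auto simp: ia compositions_def)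
    have ak: "a k = undefined" using a(2) insert.hyps by (auto simp: PiE_iff extensional_def)
    have s: "sum (a(k := i)) M = sum a M" "?P M (a(k := i)) = ?P M a"
      using insert.hyps by (auto intro!: sum.cong prod.cong)
    show "(case p of (i, a) \<Rightarrow> a(k := i)) \<in> compositions (insert k M) n"
      using a insert.hyps s by (simp add: ia compositions_def PiE_iff extensional_def)
    show "(\<lambda>a. (a k, a(k := undefined))) (case p of (i, a) \<Rightarrow> a(k := i)) = p"
      using ak by (simp add: ia fun_upd_idem)
    show "?P (insert k M) (case p of (i, a) \<Rightarrow> a(k := i)) = (case p of (i, a) \<Rightarrow> x k ^ i / fact i * ?P M a)"
      unfolding ia prod.case using insert.hyps s(2) by simp
  next
    fix a assume a: "a \<in> compositions (insert k M) n"
    have s: "sum (a(k := undefined)) M = sum a M" using insert.hyps by (auto intro!: sum.cong)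
    have "sum a M = n - a k" "a k \<le> n" using a insert.hyps by (auto simp: compositions_def)
    thus "(a k, a(k := undefined)) \<in> (SIGMA i:{..n}. compositions M (n - i))"
      using a s by (auto simp: compositions_def PiE_iff extensional_def)
    show "(case (a k, a(k := undefined)) of (i, a) \<Rightarrow> a(k := i)) = a" by simp
  qed
  finally show ?case .
qed

section \<open>Volumes by slicing\<close>

text \<open>
  The value of the linear form \<open>l\<close> at the greedy vertex, when the elements of \<open>S\<close> have already
  been processed.
\<close>

fun greedy :: "('a \<Rightarrow> real) \<Rightarrow> ('a set \<Rightarrow> real) \<Rightarrow> 'a set \<Rightarrow> 'a list \<Rightarrow> real" where
  "greedy l w S [] = 0"
| "greedy l w S (a # xs) = l a * (w (insert a S) - w S) + greedy l w (insert a S) xs"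

section \<open>Inserting one element into an ordering\<close>

fun inserts :: "'a \<Rightarrow> 'a list \<Rightarrow> 'a list list" where
  "inserts n [] = [[n]]"
| "inserts n (a # xs) = (n # a # xs) # map ((#) a) (inserts n xs)"

text \<open>
  The divided differences that arise when \<open>n\<close> moves through the list; they are what is left of the
  fundamental theorem of calculus on the intervals where the sliced greedy vertex moves linearly.
\<close>

fun insert_diff :: "('a \<Rightarrow> real) \<Rightarrow> 'a \<Rightarrow> ('a list \<Rightarrow> real) \<Rightarrow> 'a list \<Rightarrow> real" where
  "insert_diff l n F [] = 0"
| "insert_diff l n F (a # xs) =
     (F (n # a # xs) - F (a # n # xs)) / (l n - l a) + insert_diff l n (\<lambda>ys. F (a # ys)) xs"

text \<open>With \<open>n\<close> placed between neighbours \<open>a\<close> and \<open>b\<close>,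
  partial fractions turn the weight into
  \<open>weight l xs * (1 / (l n - l b) - 1 / (l n - l a))\<close>. Regrouping by elements of
  \<open>xs\<close> instead of gaps gives the divided differences.\<close>

lemma sum_inserts_weight:
  assumes "xs \<noteq> []" "inj_on l (set xs)" "distinct xs" "l n \<notin> l ` set xs"
  shows "(\<Sum>ys\<leftarrow>inserts n xs. weight l ys * F ys) = weight l xs * insert_diff l n F xs"
  using assms
proof (induction xs arbitrary: F)
  case (Cons a xs)
  show ?case
  proof (cases xs)
    case Nil
    have "1 / (l a - l n) = - (1 / (l n - l a))" by (metis minus_diff_eq minus_divide_right)
    hence "1 / (l a - l n) * F [a, n] = - (1 / (l n - l a)) * F [a, n]" by simp
    thus ?thesis by (simp add: Nil diff_divide_distrib)
  next
    case xs: (Cons b zs)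
    have "l a \<noteq> l b" using Cons.prems by (auto simp: xs)
    hence ab: "l a - l b \<noteq> 0" by simp
    have na: "l n - l a \<noteq> 0" "l a - l n \<noteq> 0" and nb: "l n - l b \<noteq> 0" using Cons.prems by (auto simp: xs)
    let ?W = "weight l (b # zs)" let ?F = "\<lambda>ys. F (a # ys)"
    have IH: "(\<Sum>ys\<leftarrow>inserts n xs. weight l ys * ?F ys) = weight l xs * insert_diff l n ?F xs"
      using Cons.prems by (intro Cons.IH) (auto simp: xs)
    \<comment> \<open>The positions of \<open>n\<close> behind \<open>b\<close>: the induction
      hypothesis minus its leading summand, in which \<open>n\<close> stands before
      \<open>b\<close>.\<close>
    hence later: "(\<Sum>ys\<leftarrow>inserts n zs. weight l (b # ys) * F (a # b # ys)) =
      ?W * insert_diff l n ?F xs - ?W / (l n - l b) * F (a # n # xs)"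
      by (simp add: xs comp_def)
    have "(\<Sum>ys\<leftarrow>inserts n (a # xs). weight l ys * F ys) =
      ?W / (l a - l b) / (l n - l a) * F (n # a # xs) + ?W / (l n - l b) / (l a - l n) * F (a # n # xs)
       + (\<Sum>ys\<leftarrow>inserts n zs. weight l (a # b # ys) * F (a # b # ys))"
      by (simp add: xs comp_def)
    also have "(\<Sum>ys\<leftarrow>inserts n zs. weight l (a # b # ys) * F (a # b # ys)) =
      (\<Sum>ys\<leftarrow>inserts n zs. weight l (b # ys) * F (a # b # ys)) / (l a - l b)"
      by (simp add: divide_inverse sum_list_const_mult[symmetric] mult_ac)
    also have "?W / (l a - l b) / (l n - l a) * F (n # a # xs) + ?W / (l n - l b) / (l a - l n) * F (a # n # xs) +
        (\<Sum>ys\<leftarrow>inserts n zs. weight l (b # ys) * F (a # b # ys)) / (l a - l b)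
      = ?W / (l a - l b) * ((F (n # a # xs) - F (a # n # xs)) / (l n - l a) + insert_diff l n ?F xs)"
    proof -
      have "1 / (l n - l b) / (l a - l n) - 1 / (l n - l b) / (l a - l b) = - (1 / (l a - l b) / (l n - l a))"
        using ab na nb by (simp add: divide_simps)
      hence *: "?W * F (a # n # xs) * (1 / (l n - l b) / (l a - l n)) - ?W * F (a # n # xs) * (1 / (l n - l b) / (l a - l b)) =
        - ?W * F (a # n # xs) * (1 / (l a - l b) / (l n - l a))"
        by (metis mult_minus_left mult_minus_right right_diff_distrib)
      show ?thesis unfolding later
        using * by (simp add: add_divide_distrib diff_divide_distrib ring_distribs mult_ac)
    qed
    finally show ?thesis by (simp add: xs)
  qed
qed simp

lemma set_inserts: "set (inserts n xs) = {ys @ n # zs |ys zs. xs = ys @ zs}"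
proof (induction xs)
  case (Cons a xs)
  show ?case
  proof (intro set_eqI iffI)
    fix p assume "p \<in> set (inserts n (a # xs))"
    then consider "p = n # a # xs" | q where "q \<in> set (inserts n xs)" "p = a # q" by auto
    thus "p \<in> {ys @ n # zs |ys zs. a # xs = ys @ zs}"
    proof cases
      case 2
      then obtain ys zs where "q = ys @ n # zs" "xs = ys @ zs" by (auto simp: Cons.IH)
      hence "p = (a # ys) @ n # zs" "a # xs = (a # ys) @ zs" using 2 by simp_all
      thus ?thesis by blast
    next
      case 1
      hence "p = [] @ n # (a # xs)" "a # xs = [] @ (a # xs)" by simp_all
      thus ?thesis by blast
    qed
  next
    fix p assume "p \<in> {ys @ n # zs |ys zs. a # xs = ys @ zs}"
    then obtain ys zs where *: "p = ys @ n # zs" "a # xs = ys @ zs" by auto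
    show "p \<in> set (inserts n (a # xs))"
    proof (cases ys)
      case (Cons b ys')
      hence "ys' @ n # zs \<in> set (inserts n xs)" using * by (simp only: Cons.IH) auto
      thus ?thesis using * Cons by simp
    next
      case Nil
      hence "p = n # a # xs" using * by simp
      thus ?thesis by simp
    qed
  qed
qed auto

lemma distinct_inserts: "n \<notin> set xs \<Longrightarrow> distinct (inserts n xs)"
  by (induction xs) (auto simp: distinct_map)

text \<open>Deleting \<open>n\<close> recovers the shorter ordering, so the insertions into
  different orderings are disjoint. This is how integrating over sections raises the number of
  elements by one.\<close>

lemma sum_permutations_insert:
  assumes "finite A" "n \<notin> A"
  shows "(\<Sum>ys\<in>permutations_of_set (insert n A). f ys) =
    (\<Sum>xs\<in>permutations_of_set A. \<Sum>ys\<leftarrow>inserts n xs. (f ys :: real))"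
proof -
  have un: "permutations_of_set (insert n A) = (\<Union>xs\<in>permutations_of_set A. set (inserts n xs))"
  proof (intro set_eqI iffI)
    fix p assume p: "p \<in> permutations_of_set (insert n A)"
    hence "n \<in> set p" by (auto simp: permutations_of_set_def)
    then obtain ys zs where yz: "p = ys @ n # zs" by (auto dest: split_list)
    have d: "distinct (ys @ n # zs)" "set (ys @ n # zs) = insert n A"
      using p by (auto simp: yz permutations_of_set_def)
    hence "n \<notin> set (ys @ zs)" "insert n (set (ys @ zs)) = insert n A" by auto
    hence "set (ys @ zs) = A" using assms(2) by (metis insert_ident)
    hence "ys @ zs \<in> permutations_of_set A" using d(1) by (simp add: permutations_of_set_def)
    thus "p \<in> (\<Union>xs\<in>permutations_of_set A. set (inserts n xs))" by (auto simp: set_inserts yz)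
  next
    fix p assume "p \<in> (\<Union>xs\<in>permutations_of_set A. set (inserts n xs))"
    thus "p \<in> permutations_of_set (insert n A)"
      using assms by (auto simp: set_inserts permutations_of_set_def)
  qed
  have rem: "removeAll n p = xs" if "xs \<in> permutations_of_set A" "p \<in> set (inserts n xs)" for p xs
  proof -
    have "n \<notin> set xs" using that assms by (auto simp: permutations_of_set_def)
    thus ?thesis using that(2) by (auto simp: set_inserts removeAll_id)
  qed
  have "(\<Sum>ys\<in>permutations_of_set (insert n A). f ys) = (\<Sum>xs\<in>permutations_of_set A. \<Sum>ys\<in>set (inserts n xs). f ys)"
    unfolding un
  proof (rule sum.UNION_disjoint)
    show "\<forall>xs\<in>permutations_of_set A. \<forall>ys\<in>permutations_of_set A. xs \<noteq> ys \<longrightarrow>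
      set (inserts n xs) \<inter> set (inserts n ys) = {}"
      using rem by (metis disjoint_iff)
  qed auto
  also have "\<dots> = (\<Sum>xs\<in>permutations_of_set A. \<Sum>ys\<leftarrow>inserts n xs. f ys)"
    using assms by (intro sum.cong refl) (simp add: sum_list_distinct_conv_sum_set distinct_inserts permutations_of_set_def)
  finally show ?thesis .
qed

section \<open>Sections of a polymatroid and integration over their height\<close>

text \<open>The rank function of the section \<open>x n = t\<close>.\<close>

definition slice :: "('a set \<Rightarrow> real) \<Rightarrow> 'a \<Rightarrow> real \<Rightarrow> 'a set \<Rightarrow> real" where
  "slice w n t S = min (w S) (w (insert n S) - t)"

text \<open>The greedy value uses only increments of the rank function, so the constant
  \<open>t\<close> cancels.\<close>

lemma greedy_shift:
  assumes "\<And>S'. S \<subseteq> S' \<Longrightarrow> S' \<subseteq> S \<union> set xs \<Longrightarrow> g S' = w (insert n S') - t"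
  shows "greedy l g S xs = greedy l w (insert n S) xs"
  using assms
proof (induction xs arbitrary: S)
  case (Cons a xs)
  have "greedy l g (insert a S) xs = greedy l w (insert n (insert a S)) xs"
    by (rule Cons.IH, rule Cons.prems) auto
  moreover have "g S = w (insert n S) - t" by (rule Cons.prems) auto
  moreover have "g (insert a S) = w (insert n (insert a S)) - t" by (rule Cons.prems) auto
  ultimately show ?case by (simp add: insert_commute)
qed simp

lemma has_integral_affine_power:
  fixes a b :: real
  assumes "b \<noteq> 0" "p \<le> q"
  shows "((\<lambda>t. (a + b * t) ^ m) has_integral
    ((a + b * q) ^ Suc m - (a + b * p) ^ Suc m) / (real (Suc m) * b)) {p..q}"
proof -
  have "((\<lambda>t. (a + b * t) ^ m) has_integral
    ((a + b * q) ^ Suc m / (real (Suc m) * b) - (a + b * p) ^ Suc m / (real (Suc m) * b))) {p..q}"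
  proof (rule fundamental_theorem_of_calculus[OF assms(2)])
    fix t
    have "((\<lambda>t. a + b * t) has_real_derivative b) (at t within {p..q})"
      by (auto intro!: derivative_eq_intros)
    hence "((\<lambda>t. (a + b * t) ^ Suc m / (real (Suc m) * b)) has_real_derivative
      (1 + real m) * (b * (a + b * t) ^ m) / (real (Suc m) * b)) (at t within {p..q})"
      by (rule DERIV_cdivide[OF DERIV_power_Suc])
    also have "(1 + real m) * (b * (a + b * t) ^ m) / (real (Suc m) * b) = (a + b * t) ^ m"
      using assms(1) by simp
    finally show "((\<lambda>t. (a + b * t) ^ Suc m / (real (Suc m) * b)) has_vector_derivative (a + b * t) ^ m)
      (at t within {p..q})" by (simp only: has_real_derivative_iff_has_vector_derivative)
  qed
  thus ?thesis by (simp only: diff_divide_distrib)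
qed

text \<open>\<open>\<tau> S\<close> is the height at which the minimum in \<open>slice\<close>
  changes branch, and \<open>anti\<close> makes these heights decrease along the list. Between two
  consecutive ones the greedy vertex of the section moves linearly between the greedy vertices for
  two adjacent positions of \<open>n\<close>. The constant \<open>C\<close> collects the elements
  already processed.\<close>

lemma has_integral_slice_greedy:
  fixes w :: "'a set \<Rightarrow> real" and n :: 'a
  defines "\<tau> \<equiv> \<lambda>S. w (insert n S) - w S"
  assumes anti: "\<And>S S'. S \<subseteq> S' \<Longrightarrow> S' \<subseteq> N \<Longrightarrow> \<tau> S' \<le> \<tau> S"
    and l: "\<And>a. a \<in> N \<Longrightarrow> l n \<noteq> l a" and S: "S \<union> set xs \<subseteq> N"
  shows "((\<lambda>t. (C + l n * t + greedy l (slice w n t) S xs) ^ m) has_integral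
      insert_diff l n (\<lambda>ys. (C + greedy l w S ys) ^ Suc m / real (Suc m)) xs) {\<tau> (S \<union> set xs)..\<tau> S}"
  using S
proof (induction xs arbitrary: S C)
  case Nil
  show ?case by (simp add: has_integral_refl(2))
next
  case (Cons a xs)
  let ?f = "\<lambda>t. (C + l n * t + greedy l (slice w n t) S (a # xs)) ^ m"
  let ?S = "insert a S"
  let ?C = "C + l a * (w ?S - w S)"
  have SN: "S \<subseteq> N" "?S \<subseteq> N" using Cons.prems by auto
  have le: "\<tau> ?S \<le> \<tau> S" "\<tau> (?S \<union> set xs) \<le> \<tau> ?S" using Cons.prems by (auto intro!: anti)
  have un: "?S \<union> set xs = S \<union> set (a # xs)" by auto
  have low: "slice w n t S' = w S'" if "t \<le> \<tau> S'" for t S' using that by (simp add: slice_def \<tau>_def)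
  have high: "slice w n t S' = w (insert n S') - t" if "\<tau> S' \<le> t" for t S' using that by (simp add: slice_def \<tau>_def)
  have "((\<lambda>t. (?C + l n * t + greedy l (slice w n t) ?S xs) ^ m) has_integral
      insert_diff l n (\<lambda>ys. (?C + greedy l w ?S ys) ^ Suc m / real (Suc m)) xs) {\<tau> (?S \<union> set xs)..\<tau> ?S}"
    using Cons.prems by (intro Cons.IH) auto
  \<comment> \<open>Below \<open>\<tau> ?S\<close> the element \<open>a\<close> is still treated by
    \<open>w\<close> itself, so its contribution is constant in \<open>t\<close> and moves into
    \<open>?C\<close>.\<close>
  hence I1: "(?f has_integral insert_diff l n (\<lambda>ys. (?C + greedy l w ?S ys) ^ Suc m / real (Suc m)) xs) {\<tau> (?S \<union> set xs)..\<tau> ?S}"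
  proof (rule has_integral_eq[rotated])
    fix t assume "t \<in> {\<tau> (?S \<union> set xs)..\<tau> ?S}"
    hence "slice w n t ?S = w ?S" "slice w n t S = w S" using le by (auto intro!: low)
    thus "(?C + l n * t + greedy l (slice w n t) ?S xs) ^ m = ?f t" by (simp add: algebra_simps)
  qed
  \<comment> \<open>Above \<open>\<tau> ?S\<close> the branch changes right after \<open>S\<close>:
    the integrand becomes a power of \<open>\<alpha> + (l n - l a) * t\<close>, whose values at the
    two ends belong to the orders \<open>n, a\<close> and \<open>a, n\<close>.\<close>
  define \<alpha> where "\<alpha> = C + l a * (w (insert n ?S) - w S) + greedy l w (insert n ?S) xs"
  have b: "l n - l a \<noteq> 0" using l[of a] SN by auto
  have "(?f has_integral ((\<alpha> + (l n - l a) * \<tau> S) ^ Suc m - (\<alpha> + (l n - l a) * \<tau> ?S) ^ Suc m) / (real (Suc m) * (l n - l a))) {\<tau> ?S..\<tau> S}"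
  proof (rule has_integral_eq[rotated, OF has_integral_affine_power[OF b le(1)]])
    fix t assume t: "t \<in> {\<tau> ?S..\<tau> S}"
    have "greedy l (slice w n t) ?S xs = greedy l w (insert n ?S) xs"
    proof (rule greedy_shift)
      fix S' assume "?S \<subseteq> S'" "S' \<subseteq> ?S \<union> set xs"
      hence "\<tau> S' \<le> \<tau> ?S" using Cons.prems by (intro anti) auto
      thus "slice w n t S' = w (insert n S') - t" using t by (intro high) auto
    qed
    thus "(\<alpha> + (l n - l a) * t) ^ m = ?f t"
      using t by (simp add: low high \<alpha>_def algebra_simps)
  qed
  moreover have "\<alpha> + (l n - l a) * \<tau> S = C + greedy l w S (n # a # xs)"
    by (simp add: \<alpha>_def \<tau>_def algebra_simps insert_commute)
  moreover have "\<alpha> + (l n - l a) * \<tau> ?S = C + greedy l w S (a # n # xs)"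
    by (simp add: \<alpha>_def \<tau>_def algebra_simps)
  ultimately have I2: "(?f has_integral ((C + greedy l w S (n # a # xs)) ^ Suc m - (C + greedy l w S (a # n # xs)) ^ Suc m) / (real (Suc m) * (l n - l a))) {\<tau> ?S..\<tau> S}"
    by simp
  have "(?f has_integral insert_diff l n (\<lambda>ys. (?C + greedy l w ?S ys) ^ Suc m / real (Suc m)) xs +
     ((C + greedy l w S (n # a # xs)) ^ Suc m - (C + greedy l w S (a # n # xs)) ^ Suc m) / (real (Suc m) * (l n - l a)))
      {\<tau> (?S \<union> set xs)..\<tau> S}"
    using has_integral_combine[OF le(2,1) I1 I2] .
  also have "insert_diff l n (\<lambda>ys. (?C + greedy l w ?S ys) ^ Suc m / real (Suc m)) xs +
     ((C + greedy l w S (n # a # xs)) ^ Suc m - (C + greedy l w S (a # n # xs)) ^ Suc m) / (real (Suc m) * (l n - l a)) =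
     insert_diff l n (\<lambda>ys. (C + greedy l w S ys) ^ Suc m / real (Suc m)) (a # xs)"
    by (simp add: diff_divide_distrib add.assoc del: power_Suc of_nat_Suc)
  finally show ?case unfolding un .
qed

section \<open>Base polytopes and their sections\<close>

text \<open>
  The base polytope of \<open>w\<close> on \<open>insert v T\<close>, projected along the slack coordinate \<open>v\<close>. If
  \<open>w (insert v S)\<close> does not depend on \<open>S\<close>, the lower bounds say \<open>x \<ge> 0\<close> and this is a polymatroid.
\<close>

definition base_body :: "'a \<Rightarrow> 'a set \<Rightarrow> ('a set \<Rightarrow> real) \<Rightarrow> ('a \<Rightarrow> real) set" where
  "base_body v T w = {x. \<forall>S\<subseteq>T. sum x S \<le> w S \<and> w (insert v T) - w (insert v T - S) \<le> sum x S}"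

text \<open>Rank functions of polymatroids. Monotonicity ensures that the sections sit at
  nonnegative heights.\<close>

definition rank_fun :: "'a set \<Rightarrow> ('a set \<Rightarrow> real) \<Rightarrow> bool" where
  "rank_fun N w \<longleftrightarrow> w {} = 0 \<and> (\<forall>A B. A \<subseteq> B \<longrightarrow> B \<subseteq> N \<longrightarrow> w A \<le> w B) \<and>
     (\<forall>A B. A \<subseteq> N \<longrightarrow> B \<subseteq> N \<longrightarrow> w (A \<union> B) + w (A \<inter> B) \<le> w A + w B)"

lemma rank_fun_marginal_antimono:
  assumes "rank_fun (insert n N) w" "n \<notin> N" "S \<subseteq> S'" "S' \<subseteq> N"
  shows "w (insert n S') - w S' \<le> w (insert n S) - w S"
proof -
  have "w (insert n S \<union> S') + w (insert n S \<inter> S') \<le> w (insert n S) + w S'"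
    using assms unfolding rank_fun_def by (meson insert_mono order_trans subset_insertI)
  moreover have "insert n S \<union> S' = insert n S'" "insert n S \<inter> S' = S" using assms by auto
  ultimately show ?thesis by simp
qed

text \<open>The bound on \<open>t\<close> gives the value 0 at the empty set. For submodularity, the
  case where the minima at \<open>A\<close> and \<open>B\<close> come from different branches is
  settled by the diminishing marginals of \<open>n\<close>.\<close>

lemma rank_fun_slice:
  assumes w: "rank_fun (insert n N) w" and n: "n \<notin> N" and t: "t \<le> w {n}"
  shows "rank_fun N (slice w n t)"
  unfolding rank_fun_def
proof (intro conjI allI impI)
  have mono: "w A \<le> w B" if "A \<subseteq> B" "B \<subseteq> insert n N" for A B using w that by (auto simp: rank_fun_def)
  have sub: "w (A \<union> B) + w (A \<inter> B) \<le> w A + w B" if "A \<subseteq> insert n N" "B \<subseteq> insert n N" for A B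
    using w that by (auto simp: rank_fun_def)
  show "slice w n t {} = 0" using w t by (auto simp: slice_def rank_fun_def)
  show "slice w n t A \<le> slice w n t B" if "A \<subseteq> B" "B \<subseteq> N" for A B
  proof -
    have "w A \<le> w B" "w (insert n A) \<le> w (insert n B)" using that by (auto intro!: mono)
    thus ?thesis by (auto simp: slice_def)
  qed
  fix A B assume AB: "A \<subseteq> N" "B \<subseteq> N"
  have 1: "w (A \<union> B) + w (A \<inter> B) \<le> w A + w B" using AB by (intro sub) auto
  have "w (insert n A \<union> insert n B) + w (insert n A \<inter> insert n B) \<le> w (insert n A) + w (insert n B)"
    using AB by (intro sub) auto
  hence 2: "w (insert n (A \<union> B)) + w (insert n (A \<inter> B)) \<le> w (insert n A) + w (insert n B)"
    by (metis Un_insert_left Un_insert_right insert_absorb2 insert_inter_insert)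
  have 3: "w (insert n (A \<union> B)) - w (A \<union> B) \<le> w (insert n A) - w A"
    "w (insert n (A \<union> B)) - w (A \<union> B) \<le> w (insert n B) - w B"
    using AB by (auto intro!: rank_fun_marginal_antimono[OF w n])
  show "slice w n t (A \<union> B) + slice w n t (A \<inter> B) \<le> slice w n t A + slice w n t B"
    using 1 2 3 by (auto simp: slice_def min_def)
qed

lemma all_subset_insert: "(\<forall>S\<subseteq>insert n T. P S) \<longleftrightarrow> (\<forall>S\<subseteq>T. P S \<and> P (insert n S))"
proof (intro iffI allI impI)
  fix S assume *: "\<forall>S\<subseteq>T. P S \<and> P (insert n S)" and S: "S \<subseteq> insert n T"
  show "P S"
  proof (cases "n \<in> S")
    case True
    have "P (insert n (S - {n}))" using * S by blast
    thus ?thesis using True by (simp add: insert_absorb)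
  next
    case False
    thus ?thesis using * S by blast
  qed
qed blast

text \<open>The bounds for \<open>S\<close> and for \<open>insert n S\<close> merge into one bound
  for \<open>S\<close>, which is the minimum in \<open>slice\<close>; the case of empty
  \<open>S\<close> yields the range of \<open>t\<close>. On that range the whole ground set takes
  the second branch of \<open>slice\<close>, so the lower bounds match as well.\<close>

lemma base_body_insert_iff:
  assumes T: "finite T" "n \<notin> T" "v \<notin> insert n T"
    and w: "rank_fun (insert v (insert n T)) w"
  shows "x(n := t) \<in> base_body v (insert n T) w \<longleftrightarrow>
    t \<in> {w (insert n (insert v T)) - w (insert v T)..w {n}} \<and> x \<in> base_body v T (slice w n t)"
proof -
  let ?N' = "insert v T" let ?N = "insert n ?N'"
  have s: "sum (x(n := t)) S = sum x S" "sum (x(n := t)) (insert n S) = t + sum x S" if "S \<subseteq> T" for S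
  proof -
    have "n \<notin> S" "finite S" using that T finite_subset by auto
    thus "sum (x(n := t)) S = sum x S" by (auto intro!: sum.cong)
    thus "sum (x(n := t)) (insert n S) = t + sum x S" using \<open>n \<notin> S\<close> \<open>finite S\<close> by simp
  qed
  have d: "?N - S = insert n (?N' - S)" "?N - insert n S = ?N' - S" if "S \<subseteq> T" for S
    using that T by auto
  have ins: "insert v (insert n T) = ?N" by auto
  have "x(n := t) \<in> base_body v (insert n T) w \<longleftrightarrow> (\<forall>S\<subseteq>T.
     sum x S \<le> w S \<and> w ?N - w (insert n (?N' - S)) \<le> sum x S \<and>
     t + sum x S \<le> w (insert n S) \<and> w ?N - w (?N' - S) \<le> t + sum x S)"
    unfolding base_body_def mem_Collect_eq all_subset_insert ins
    using s d by (metis (no_types, lifting))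
  also have "\<dots> \<longleftrightarrow> t \<in> {w ?N - w ?N'..w {n}} \<and> x \<in> base_body v T (slice w n t)" (is "?L \<longleftrightarrow> ?R")
  proof
    assume L: ?L
    have t: "t \<le> w {n}" "w ?N - w ?N' \<le> t" using L[rule_format, of "{}"] by auto
    have "slice w n t ?N' = w ?N - t" using t by (simp add: slice_def)
    thus ?R using L t by (auto simp: base_body_def slice_def min_def algebra_simps)
  next
    assume R: ?R
    hence t: "t \<le> w {n}" "w ?N - w ?N' \<le> t" by auto
    have sl: "slice w n t ?N' = w ?N - t" using t by (simp add: slice_def)
    show ?L
    proof (intro allI impI)
      fix S assume S: "S \<subseteq> T"
      have 1: "sum x S \<le> slice w n t S" "slice w n t ?N' - slice w n t (?N' - S) \<le> sum x S"
        using R S by (auto simp: base_body_def)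
      show "sum x S \<le> w S \<and> w ?N - w (insert n (?N' - S)) \<le> sum x S \<and>
        t + sum x S \<le> w (insert n S) \<and> w ?N - w (?N' - S) \<le> t + sum x S"
        using 1(1) 1(2)[unfolded sl] by (auto simp: slice_def)
    qed
  qed
  finally show ?thesis .
qed

section \<open>Integrals of powers of a linear form\<close>

lemma base_body_measurable:
  assumes "finite T"
  shows "base_body v T w \<inter> space (Pi\<^sub>M T (\<lambda>_. lborel)) \<in> sets (Pi\<^sub>M T (\<lambda>_. lborel))"
proof -
  let ?M = "Pi\<^sub>M T (\<lambda>_. lborel :: real measure)"
  have [measurable]: "(\<lambda>x. sum x S) \<in> borel_measurable ?M" if "S \<in> Pow T" for S
    using that by (intro borel_measurable_sum) auto
  have "{x \<in> space ?M. \<forall>S\<in>Pow T. sum x S \<le> w S \<and> w (insert v T) - w (insert v T - S) \<le> sum x S} \<in> sets ?M"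
    using assms by (intro sets.sets_Collect_finite_All) auto
  also have "{x \<in> space ?M. \<forall>S\<in>Pow T. sum x S \<le> w S \<and> w (insert v T) - w (insert v T - S) \<le> sum x S} =
    base_body v T w \<inter> space ?M" by (auto simp: base_body_def)
  finally show ?thesis .
qed

text \<open>The volume is the case \<open>k = 0\<close>, \<open>c = 0\<close>. The constant
  \<open>c\<close> lets the induction absorb the contribution \<open>l n * t\<close> of a fixed
  coordinate, and each integration raises the exponent by one. The sign conditions and the claim
  \<open>0 \<le> R\<close> keep the passage to \<open>ennreal\<close> faithful.\<close>

lemma nn_integral_base_body:
  fixes k :: nat
  assumes "finite T" "v \<notin> T" "inj_on l (insert v T)" "l v = 0" "\<And>i. i \<in> T \<Longrightarrow> 0 \<le> l i"
    and "rank_fun (insert v T) w" "0 \<le> c"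
  defines "R \<equiv> fact k / fact (k + card T) *
    (\<Sum>xs\<in>permutations_of_set (insert v T). weight l xs * (c + greedy l w {} xs) ^ (k + card T))"
  shows "0 \<le> R \<and> (\<integral>\<^sup>+x. indicator (base_body v T w) x * ennreal ((c + (\<Sum>i\<in>T. l i * x i)) ^ k)
    \<partial>Pi\<^sub>M T (\<lambda>_. lborel)) = ennreal R"
  using assms(1-7) unfolding R_def
proof (induction T arbitrary: w c rule: finite_induct)
  case empty
  interpret product_sigma_finite "\<lambda>_ :: 'a. lborel :: real measure" by standard
  have "(\<lambda>_. undefined) \<in> base_body v {} w" using empty by (simp add: base_body_def rank_fun_def)
  thus ?case using empty by (simp add: nn_integral_empty)
next
  case (insert n T)
  interpret product_sigma_finite "\<lambda>_ :: 'a. lborel :: real measure" by standard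
  let ?N' = "insert v T" let ?N = "insert n ?N'" let ?m = "k + card T"
  have ins: "insert v (insert n T) = ?N" by auto
  note w = insert.prems(5)[unfolded ins]
  have nN: "n \<notin> ?N'" "finite ?N'" using insert by auto
  have inj: "inj_on l ?N'" using insert.prems by (auto intro: inj_on_subset)
  define \<alpha> where "\<alpha> = w ?N - w ?N'"
  define \<beta> where "\<beta> = w {n}"
  have "w ?N' \<le> w ?N" using w unfolding rank_fun_def by blast
  hence \<alpha>0: "0 \<le> \<alpha>" by (simp add: \<alpha>_def)
  \<comment> \<open>The value that the induction hypothesis gives for the section at height
    \<open>t\<close>, with \<open>c + l n * t\<close> as the new constant.\<close>
  define G where "G t = fact k / fact ?m * (\<Sum>xs\<in>permutations_of_set ?N'.
     weight l xs * (c + l n * t + greedy l (slice w n t) {} xs) ^ ?m)" for t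
  define R where "R = fact k / fact (k + card (insert n T)) *
    (\<Sum>xs\<in>permutations_of_set ?N. weight l xs * (c + greedy l w {} xs) ^ (k + card (insert n T)))"
  have IH: "0 \<le> G t \<and> (\<integral>\<^sup>+x. indicator (base_body v T (slice w n t)) x * ennreal ((c + l n * t + (\<Sum>i\<in>T. l i * x i)) ^ k)
    \<partial>Pi\<^sub>M T (\<lambda>_. lborel)) = ennreal (G t)" if t: "t \<in> {\<alpha>..\<beta>}" for t
    unfolding G_def
  proof (rule insert.IH)
    show "rank_fun ?N' (slice w n t)" using t by (intro rank_fun_slice[OF w nN(1)]) (auto simp: \<beta>_def)
    show "0 \<le> c + l n * t" using t \<alpha>0 insert.prems by (auto intro!: add_nonneg_nonneg mult_nonneg_nonneg)
  qed (use insert.prems inj in auto)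
  \<comment> \<open>Each ordering of \<open>?N'\<close> is integrated separately; the resulting
    divided differences reassemble into a sum over the orderings of \<open>?N\<close>.\<close>
  have GR: "(G has_integral R) {\<alpha>..\<beta>}"
  proof -
    have 1: "((\<lambda>t. (c + l n * t + greedy l (slice w n t) {} xs) ^ ?m) has_integral
      insert_diff l n (\<lambda>ys. (c + greedy l w {} ys) ^ Suc ?m / real (Suc ?m)) xs) {\<alpha>..\<beta>}"
      if "xs \<in> permutations_of_set ?N'" for xs
    proof -
      have xs: "set xs = ?N'" using that by (simp add: permutations_of_set_def)
      have "((\<lambda>t. (c + l n * t + greedy l (slice w n t) {} xs) ^ ?m) has_integral
        insert_diff l n (\<lambda>ys. (c + greedy l w {} ys) ^ Suc ?m / real (Suc ?m)) xs)
        {w (insert n ({} \<union> set xs)) - w ({} \<union> set xs)..w (insert n {}) - w {}}"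
      proof (rule has_integral_slice_greedy[where N = ?N'])
        show "l n \<noteq> l a" if "a \<in> ?N'" for a
          using insert.prems(2) that nN(1) unfolding ins by (auto simp: inj_on_def)
      qed (use xs rank_fun_marginal_antimono[OF w nN(1)] in auto)
      thus ?thesis using w by (simp add: xs \<alpha>_def \<beta>_def rank_fun_def)
    qed
    have "(G has_integral fact k / fact ?m * (\<Sum>xs\<in>permutations_of_set ?N'.
      weight l xs * insert_diff l n (\<lambda>ys. (c + greedy l w {} ys) ^ Suc ?m / real (Suc ?m)) xs)) {\<alpha>..\<beta>}"
      unfolding G_def by (intro has_integral_mult_right has_integral_sum 1) auto
    also have "(\<Sum>xs\<in>permutations_of_set ?N'.
        weight l xs * insert_diff l n (\<lambda>ys. (c + greedy l w {} ys) ^ Suc ?m / real (Suc ?m)) xs) =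
      (\<Sum>xs\<in>permutations_of_set ?N'. \<Sum>ys\<leftarrow>inserts n xs. weight l ys * ((c + greedy l w {} ys) ^ Suc ?m / real (Suc ?m)))"
    proof (intro sum.cong refl sum_inserts_weight[symmetric])
      fix xs assume "xs \<in> permutations_of_set ?N'"
      hence xs: "set xs = ?N'" "distinct xs" by (auto simp: permutations_of_set_def)
      show "xs \<noteq> []" "inj_on l (set xs)" "distinct xs" using xs inj by auto
      show "l n \<notin> l ` set xs" using insert.prems(2) nN(1) unfolding ins xs by auto
    qed
    also have "\<dots> = (\<Sum>ys\<in>permutations_of_set ?N. weight l ys * ((c + greedy l w {} ys) ^ Suc ?m / real (Suc ?m)))"
      by (rule sum_permutations_insert[symmetric, OF nN(2,1)])
    also have "fact k / fact ?m * \<dots> = R"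
    proof -
      have "(\<Sum>ys\<in>permutations_of_set ?N. weight l ys * ((c + greedy l w {} ys) ^ Suc ?m / real (Suc ?m))) =
        (\<Sum>ys\<in>permutations_of_set ?N. weight l ys * (c + greedy l w {} ys) ^ Suc ?m) / real (Suc ?m)"
        by (simp only: sum_divide_distrib times_divide_eq_right)
      thus ?thesis using insert.hyps by (simp add: R_def)
    qed
    finally show ?thesis .
  qed
  have R0: "0 \<le> R" using GR IH by (intro has_integral_nonneg[OF GR]) auto
  let ?F = "\<lambda>x. indicator (base_body v (insert n T) w) x * ennreal ((c + (\<Sum>i\<in>insert n T. l i * x i)) ^ k)"
  have meas: "?F \<in> borel_measurable (Pi\<^sub>M (insert n T) (\<lambda>_. lborel))"
  proof -
    have [measurable]: "(indicator (base_body v (insert n T) w) :: _ \<Rightarrow> ennreal) \<in> borel_measurable (Pi\<^sub>M (insert n T) (\<lambda>_. lborel))"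
      using base_body_measurable[of "insert n T" v w] insert.hyps
      by (simp add: borel_measurable_indicator_iff Int_commute)
    have [measurable]: "(\<lambda>x. \<Sum>i\<in>insert n T. l i * x i) \<in> borel_measurable (Pi\<^sub>M (insert n T) (\<lambda>_. lborel :: real measure))"
      by (intro borel_measurable_sum borel_measurable_times) auto
    show ?thesis by measurable
  qed
  have "(\<integral>\<^sup>+x. ?F x \<partial>Pi\<^sub>M (insert n T) (\<lambda>_. lborel)) =
    (\<integral>\<^sup>+t. (\<integral>\<^sup>+x. ?F (x(n := t)) \<partial>Pi\<^sub>M T (\<lambda>_. lborel)) \<partial>lborel)"
    by (rule product_nn_integral_insert_rev[OF insert.hyps meas])
  also have "\<dots> = (\<integral>\<^sup>+t. indicator {\<alpha>..\<beta>} t * ennreal (G t) \<partial>lborel)"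
  proof (rule nn_integral_cong)
    fix t :: real
    have F: "?F (x(n := t)) = indicator {\<alpha>..\<beta>} t *
      (indicator (base_body v T (slice w n t)) x * ennreal ((c + l n * t + (\<Sum>i\<in>T. l i * x i)) ^ k))" for x
    proof -
      have "(\<Sum>i\<in>insert n T. l i * (x(n := t)) i) = l n * t + (\<Sum>i\<in>T. l i * x i)"
        using insert.hyps by (simp add: sum.insert_if) (auto intro!: sum.cong)
      moreover have "x(n := t) \<in> base_body v (insert n T) w \<longleftrightarrow> t \<in> {\<alpha>..\<beta>} \<and> x \<in> base_body v T (slice w n t)"
        unfolding \<alpha>_def \<beta>_def using insert.hyps insert.prems by (intro base_body_insert_iff) auto
      ultimately show ?thesis by (auto simp: indicator_def add.assoc)
    qed
    show "(\<integral>\<^sup>+x. ?F (x(n := t)) \<partial>Pi\<^sub>M T (\<lambda>_. lborel)) = indicator {\<alpha>..\<beta>} t * ennreal (G t)"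
    proof (cases "t \<in> {\<alpha>..\<beta>}")
      case True
      thus ?thesis unfolding F using IH[OF True] by simp
    next
      case False
      thus ?thesis unfolding F by simp
    qed
  qed
  also have "\<dots> = (\<integral>\<^sup>+t. ennreal (indicator {\<alpha>..\<beta>} t * G t) \<partial>lborel)"
    by (intro nn_integral_cong) (auto simp: indicator_def)
  also have "\<dots> = ennreal R"
    by (rule nn_integral_has_integral_lebesgue[OF _ GR]) (use IH in auto)
  finally show ?case using R0 by (simp only: R_def ins)
qed

section \<open>Parking function polytopes\<close>

text \<open>For nondecreasing \<open>u\<close> and \<open>k \<le> n\<close> this is the sum of the
  \<open>k\<close> largest entries, the rank of a set of \<open>k\<close> coordinates.\<close>

definition topsum :: "nat \<Rightarrow> (nat \<Rightarrow> real) \<Rightarrow> nat \<Rightarrow> real" where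
  "topsum n u k = sum u {n - k<..n}"

lemma topsum_Suc: "k < n \<Longrightarrow> topsum n u (Suc k) = u (n - k) + topsum n u k"
proof -
  assume "k < n"
  hence "{n - Suc k<..n} = insert (n - k) {n - k<..n}" by auto
  thus ?thesis by (simp add: topsum_def)
qed

lemma topsum_0 [simp]: "topsum n u 0 = 0" by (simp add: topsum_def)

text \<open>Remove the least index \<open>i\<close> of \<open>T\<close>: since \<open>T\<close> lies
  in \<open>{i..n}\<close>, there is room for \<open>i \<le> n - k\<close>, so \<open>u i\<close> is
  at most the last summand of \<open>topsum\<close>.\<close>

lemma sum_le_topsum:
  assumes u: "mono_on {1..n} u" and T: "T \<subseteq> {1..n}"
  shows "sum u T \<le> topsum n u (card T)"
  using T
proof (induction "card T" arbitrary: T)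
  case 0
  hence "T = {}" using finite_subset[of T "{1..n}"] by auto
  thus ?case by simp
next
  case (Suc k)
  have fT: "finite T" using Suc.prems finite_subset by blast
  have ne: "T \<noteq> {}" using Suc.hyps by auto
  define i where "i = Min T"
  have i: "i \<in> T" using fT ne by (simp add: i_def)
  have ck: "card (T - {i}) = k" using Suc.hyps(2) i fT by simp
  have "T \<subseteq> {i..n}" using Suc.prems fT by (auto simp: i_def)
  hence "card T \<le> card {i..n}" by (intro card_mono) auto
  hence ik: "i + k \<le> n" using Suc.hyps(2) by simp
  have i1: "1 \<le> i" using i Suc.prems by auto
  have "u i \<le> u (n - k)" using ik i1 by (intro mono_onD[OF u]) auto
  moreover have "sum u (T - {i}) \<le> topsum n u k"
    using Suc.hyps(1)[of "T - {i}"] ck Suc.prems by auto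
  moreover have "sum u T = u i + sum u (T - {i})" using fT i by (rule sum.remove)
  moreover have "topsum n u (Suc k) = u (n - k) + topsum n u k" using ik i1 by (intro topsum_Suc) auto
  ultimately show ?case unfolding Suc.hyps(2)[symmetric] by linarith
qed

lemma topsum_mono:
  assumes "\<forall>i\<in>{1..n}. 0 \<le> u i" "k \<le> k'"
  shows "topsum n u k \<le> topsum n u k'"
  unfolding topsum_def using assms by (intro sum_mono2) auto

text \<open>The successive increments are the entries of \<open>u\<close> read from the top, hence
  decreasing. This is the source of submodularity.\<close>

lemma topsum_concave:
  assumes u: "mono_on {1..n} u" and "k \<le> k'" "k' + d \<le> n"
  shows "topsum n u (k' + d) - topsum n u k' \<le> topsum n u (k + d) - topsum n u k"
  using assms(3)
proof (induction d)
  case (Suc d)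
  have "u (n - (k' + d)) \<le> u (n - (k + d))" using Suc.prems assms(2) by (intro mono_onD[OF u]) auto
  thus ?case using Suc assms(2) by (simp add: topsum_Suc)
qed simp

section \<open>Parking functions through permutations\<close>

lemma obtain_sorted_enumeration:
  fixes f :: "'n::finite \<Rightarrow> real"
  obtains ys where "distinct ys" "set ys = UNIV" "length ys = CARD('n)" "sorted (map f ys)"
    "sorted_list_of_multiset (image_mset f (mset_set UNIV)) = map f ys"
proof -
  obtain xs where xs: "set xs = (UNIV :: 'n set)" "distinct xs" using finite_distinct_list[of "UNIV :: 'n set"] by auto
  define ys where "ys = sort_key f xs"
  have "mset_set UNIV = mset ys" using xs by (simp add: ys_def mset_set_set[symmetric])
  hence "image_mset f (mset_set UNIV) = mset (map f ys)" by simp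
  moreover have "sorted (map f ys)" by (simp add: ys_def)
  ultimately have "sorted_list_of_multiset (image_mset f (mset_set UNIV)) = map f ys"
    by (simp only: sorted_list_of_multiset_mset sorted_sort_id)
  moreover have "distinct ys" "set ys = UNIV" using xs by (auto simp: ys_def)
  moreover have "length ys = CARD('n)" using calculation by (metis distinct_card)
  ultimately show ?thesis using that \<open>sorted (map f ys)\<close> by blast
qed

text \<open>Replaces the sorted rearrangement by any assignment of coordinates to bounds; such an
  assignment can be read off or built directly in the later proofs.\<close>

lemma is_parking_function_iff:
  fixes a :: "real ^ 'n"
  assumes u: "mono_on {1..CARD('n)} u"
  shows "is_parking_function u a \<longleftrightarrow>
    (\<forall>j. 0 \<le> a $ j) \<and> (\<exists>\<sigma>. bij_betw \<sigma> {1..CARD('n)} UNIV \<and> (\<forall>i\<in>{1..CARD('n)}. a $ \<sigma> i \<le> u i))"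
proof -
  let ?n = "CARD('n)"
  obtain ys where ys: "distinct ys" "set ys = UNIV" "length ys = ?n" "sorted (map (($) a) ys)"
    "sorted_list_of_multiset (image_mset (($) a) (mset_set UNIV)) = map (($) a) ys"
    using obtain_sorted_enumeration[of "($) a"] by blast
  have re: "rearrangement a i = a $ (ys ! (i - 1))" if "i \<in> {1..?n}" for i
    unfolding rearrangement_def ys(5) using that ys(3) by (subst nth_map) auto
  have bij: "bij_betw (\<lambda>i. ys ! (i - 1)) {1..?n} UNIV"
  proof -
    have "bij_betw ((!) ys) {..<?n} UNIV" using bij_betw_nth[OF ys(1), of "{..<?n}" UNIV] ys by simp
    moreover have "bij_betw (\<lambda>i. i - 1) {1..?n} {..<?n}"
      by (rule bij_betw_byWitness[where f' = Suc]) auto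
    ultimately have "bij_betw ((!) ys \<circ> (\<lambda>i. i - 1)) {1..?n} UNIV" by (rule bij_betw_trans[rotated])
    thus ?thesis by (simp add: comp_def)
  qed
  show ?thesis
  proof
    assume "is_parking_function u a"
    thus "(\<forall>j. 0 \<le> a $ j) \<and> (\<exists>\<sigma>. bij_betw \<sigma> {1..?n} UNIV \<and> (\<forall>i\<in>{1..?n}. a $ \<sigma> i \<le> u i))"
      using bij re by (auto simp: is_parking_function_def)
  next
    assume "(\<forall>j. 0 \<le> a $ j) \<and> (\<exists>\<sigma>. bij_betw \<sigma> {1..?n} UNIV \<and> (\<forall>i\<in>{1..?n}. a $ \<sigma> i \<le> u i))"
    then obtain \<sigma> where a: "\<And>j. 0 \<le> a $ j" and \<sigma>: "bij_betw \<sigma> {1..?n} UNIV" "\<And>i. i \<in> {1..?n} \<Longrightarrow> a $ \<sigma> i \<le> u i"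
      by auto
    have "rearrangement a i \<le> u i" if i: "i \<in> {1..?n}" for i
    proof (rule ccontr)
      assume "\<not> rearrangement a i \<le> u i"
      hence gt: "u i < a $ (ys ! (i - 1))" using re[OF i] by simp
      \<comment> \<open>Pigeonhole: the \<open>?n + 1 - i\<close> coordinates in \<open>?A\<close>
        exceed \<open>u i\<close>, the \<open>i\<close> coordinates in \<open>?B\<close> do not, and
        together they are too many.\<close>
      let ?A = "(\<lambda>j. ys ! (j - 1)) ` {i..?n}" and ?B = "\<sigma> ` {1..i}"
      have "u i < a $ (ys ! (j - 1))" if "j \<in> {i..?n}" for j
      proof -
        have "map (($) a) ys ! (i - 1) \<le> map (($) a) ys ! (j - 1)"
          using that i ys(3) by (intro sorted_nth_mono[OF ys(4)]) auto
        moreover have "i - 1 < length ys" "j - 1 < length ys" using that i ys(3) by auto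
        ultimately have "a $ (ys ! (i - 1)) \<le> a $ (ys ! (j - 1))" by simp
        thus ?thesis using gt by linarith
      qed
      moreover have "a $ \<sigma> j \<le> u i" if "j \<in> {1..i}" for j
        using \<sigma>(2)[of j] mono_onD[OF u, of j i] that i by force
      ultimately have disj: "?A \<inter> ?B = {}" by force
      have "inj_on (\<lambda>j. ys ! (j - 1)) {i..?n}" "inj_on \<sigma> {1..i}"
        using bij \<sigma>(1) i by (auto simp: bij_betw_def intro: inj_on_subset)
      hence "card ?A = ?n + 1 - i" "card ?B = i" by (simp_all add: card_image)
      hence "card (?A \<union> ?B) = ?n + 1" using disj i by (subst card_Un_disjoint) auto
      moreover have "card (?A \<union> ?B) \<le> ?n" by (rule card_mono) auto
      ultimately show False by simp
    qed
    thus "is_parking_function u a" using a by (simp add: is_parking_function_def)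
  qed
qed

lemma sum_parking_function_le:
  fixes a :: "real ^ 'n"
  assumes u: "mono_on {1..CARD('n)} u" and a: "is_parking_function u a"
  shows "(\<Sum>j\<in>S. a $ j) \<le> topsum CARD('n) u (card S)"
proof -
  obtain \<sigma> where \<sigma>: "bij_betw \<sigma> {1..CARD('n)} UNIV" "\<And>i. i \<in> {1..CARD('n)} \<Longrightarrow> a $ \<sigma> i \<le> u i"
    using a by (auto simp: is_parking_function_iff[OF u])
  define T where "T = {i \<in> {1..CARD('n)}. \<sigma> i \<in> S}"
  have bij: "bij_betw \<sigma> T S"
  proof (rule bij_betw_subset[OF \<sigma>(1)])
    show "\<sigma> ` T = S"
    proof
      show "S \<subseteq> \<sigma> ` T"
      proof
        fix j assume "j \<in> S"
        moreover obtain i where "i \<in> {1..CARD('n)}" "j = \<sigma> i"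
          using \<sigma>(1) unfolding bij_betw_def by (metis UNIV_I imageE)
        ultimately show "j \<in> \<sigma> ` T" by (auto simp: T_def)
      qed
    qed (auto simp: T_def)
  qed (auto simp: T_def)
  have "(\<Sum>j\<in>S. a $ j) = (\<Sum>i\<in>T. a $ \<sigma> i)" using bij by (rule sum.reindex_bij_betw[symmetric])
  also have "\<dots> \<le> sum u T" using \<sigma>(2) by (intro sum_mono) (auto simp: T_def)
  also have "\<dots> \<le> topsum CARD('n) u (card T)" by (rule sum_le_topsum[OF u]) (auto simp: T_def)
  also have "card T = card S" using bij by (rule bij_betw_same_card)
  finally show ?thesis .
qed

text \<open>Put the largest entries of \<open>u\<close> on \<open>S\<close> and the others on the
  complement. So the bound on the coordinate sum over \<open>S\<close> is attained.\<close>

lemma exists_parking_function_topsum: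
  fixes S :: "'n::finite set"
  assumes u: "mono_on {1..CARD('n)} u" and nonneg: "\<forall>i\<in>{1..CARD('n)}. 0 \<le> u i"
  shows "\<exists>a :: real ^ 'n. is_parking_function u a \<and> (\<Sum>j\<in>S. a $ j) = topsum CARD('n) u (card S)"
proof -
  let ?n = "CARD('n)" let ?T = "{?n - card S<..?n}"
  have le: "card S \<le> ?n" by (rule card_mono) auto
  have "card ?T = card S" using le by simp
  then obtain f where f: "bij_betw f ?T S" using finite_same_card_bij[of ?T S] by auto
  have "card {1..?n - card S} = card (- S)" by (simp add: Compl_eq_Diff_UNIV card_Diff_subset)
  then obtain g where g: "bij_betw g {1..?n - card S} (- S)" using finite_same_card_bij[of "{1..?n - card S}" "- S"] by auto
  define \<sigma> where "\<sigma> i = (if i \<in> ?T then f i else g i)" for i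
  have sf: "bij_betw \<sigma> ?T S" using f by (rule bij_betw_cong[THEN iffD1, rotated]) (simp add: \<sigma>_def)
  have sg: "bij_betw \<sigma> {1..?n - card S} (- S)" using g by (rule bij_betw_cong[THEN iffD1, rotated]) (simp add: \<sigma>_def)
  have "bij_betw \<sigma> ({1..?n - card S} \<union> ?T) (- S \<union> S)" using sg sf by (rule bij_betw_combine) auto
  moreover have "{1..?n - card S} \<union> ?T = {1..?n}" by auto
  ultimately have \<sigma>: "bij_betw \<sigma> {1..?n} UNIV" by simp
  define a :: "real ^ 'n" where "a = (\<chi> j. u (the_inv_into {1..?n} \<sigma> j))"
  have a\<sigma>: "a $ \<sigma> i = u i" if "i \<in> {1..?n}" for i
    using \<sigma> that by (simp add: a_def bij_betw_def the_inv_into_f_f)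
  have "0 \<le> a $ j" for j
  proof -
    obtain i where "i \<in> {1..?n}" "j = \<sigma> i" using \<sigma> unfolding bij_betw_def by (metis UNIV_I imageE)
    thus ?thesis using a\<sigma> nonneg by simp
  qed
  hence "is_parking_function u a" using \<sigma> a\<sigma> by (auto simp: is_parking_function_iff[OF u])
  moreover have "(\<Sum>j\<in>S. a $ j) = (\<Sum>i\<in>?T. a $ \<sigma> i)" using sf by (rule sum.reindex_bij_betw[symmetric])
  moreover have "\<dots> = topsum ?n u (card S)" unfolding topsum_def by (intro sum.cong refl a\<sigma>) auto
  ultimately show ?thesis by auto
qed

text \<open>A finite union of boxes, one for each bijection; extensional functions make the index
  set finite.\<close>

lemma compact_parking_functions:
  assumes u: "mono_on {1..CARD('n)} u"
  shows "compact {a :: real ^ 'n. is_parking_function u a}"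
proof -
  let ?n = "CARD('n)"
  let ?F = "{\<sigma> \<in> {1..?n} \<rightarrow>\<^sub>E (UNIV :: 'n set). bij_betw \<sigma> {1..?n} UNIV}"
  let ?B = "\<lambda>\<sigma>. cbox (0 :: real ^ 'n) (\<chi> j. u (the_inv_into {1..?n} \<sigma> j))"
  have B: "a \<in> ?B \<sigma> \<longleftrightarrow> (\<forall>j. 0 \<le> a $ j) \<and> (\<forall>i\<in>{1..?n}. a $ \<sigma> i \<le> u i)" if \<sigma>: "bij_betw \<sigma> {1..?n} UNIV" for a \<sigma>
  proof -
    have inj: "inj_on \<sigma> {1..?n}" and im: "\<sigma> ` {1..?n} = UNIV" using \<sigma> by (auto simp: bij_betw_def)
    have "(\<forall>j. a $ j \<le> u (the_inv_into {1..?n} \<sigma> j)) \<longleftrightarrow> (\<forall>j\<in>\<sigma> ` {1..?n}. a $ j \<le> u (the_inv_into {1..?n} \<sigma> j))"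
      unfolding im by simp
    also have "\<dots> \<longleftrightarrow> (\<forall>i\<in>{1..?n}. a $ \<sigma> i \<le> u i)"
      unfolding ball_simps using inj by (simp add: the_inv_into_f_f)
    finally show ?thesis by (auto simp: mem_box_cart)
  qed
  have "{a :: real ^ 'n. is_parking_function u a} = (\<Union>\<sigma>\<in>?F. ?B \<sigma>)"
  proof (intro set_eqI iffI)
    fix a :: "real ^ 'n" assume "a \<in> {a. is_parking_function u a}"
    then obtain \<sigma> where a: "\<forall>j. 0 \<le> a $ j" and \<sigma>: "bij_betw \<sigma> {1..?n} UNIV" "\<forall>i\<in>{1..?n}. a $ \<sigma> i \<le> u i"
      by (auto simp: is_parking_function_iff[OF u])
    let ?\<sigma> = "restrict \<sigma> {1..?n}"
    have b: "bij_betw ?\<sigma> {1..?n} UNIV" using \<sigma>(1) by (subst bij_betw_restrict_eq)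
    hence "a \<in> ?B ?\<sigma>" using a \<sigma>(2) B by simp
    moreover have "?\<sigma> \<in> ?F" using b by simp
    ultimately show "a \<in> (\<Union>\<sigma>\<in>?F. ?B \<sigma>)" by blast
  next
    fix a :: "real ^ 'n" assume "a \<in> (\<Union>\<sigma>\<in>?F. ?B \<sigma>)"
    thus "a \<in> {a. is_parking_function u a}" using B by (auto simp: is_parking_function_iff[OF u])
  qed
  moreover have "finite ?F" by (rule finite_subset[OF _ finite_PiE[of "{1..?n}" "\<lambda>_. UNIV"]]) auto
  ultimately show ?thesis by (auto intro!: compact_UN compact_cbox)
qed

section \<open>The inequality description of \<open>PF u\<close>\<close>

text \<open>Summation by parts, carried out from the top index down: each weighted tail dominates
  its smallest weight times the plain tail.\<close>

lemma sum_mult_nonneg_tails: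
  fixes d z :: "nat \<Rightarrow> real"
  assumes d: "mono_on {1..n} d" "\<And>i. i \<in> {1..n} \<Longrightarrow> 0 \<le> d i"
    and z: "\<And>j. j \<in> {1..n} \<Longrightarrow> 0 \<le> sum z {j..n}"
  shows "0 \<le> (\<Sum>i\<in>{1..n}. d i * z i)"
proof (cases "n = 0")
  case False
  have "d k * sum z {k..n} \<le> (\<Sum>i\<in>{k..n}. d i * z i)" if "1 \<le> k" "k \<le> n" for k
    using that(2,1)
  proof (induction k rule: inc_induct)
    case (step k)
    have "d k * sum z {Suc k..n} \<le> d (Suc k) * sum z {Suc k..n}"
      using step z[of "Suc k"] by (intro mult_right_mono mono_onD[OF d(1)]) auto
    also have "\<dots> \<le> (\<Sum>i\<in>{Suc k..n}. d i * z i)" using step by simp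
    finally show ?case using step by (simp add: sum.atLeast_Suc_atMost distrib_left)
  qed simp
  from this[of 1] False have "d 1 * sum z {1..n} \<le> (\<Sum>i\<in>{1..n}. d i * z i)" by simp
  moreover have "0 \<le> d 1 * sum z {1..n}" using False d(2)[of 1] z[of 1] by simp
  ultimately show ?thesis by linarith
qed simp

text \<open>A point satisfying the inequalities but outside the hull would be strictly separated
  from it; the parking function that is best for the separating direction does at least as well as
  the point, a contradiction.\<close>

lemma PF_eq:
  assumes u: "mono_on {1..CARD('n)} u" and nonneg: "\<forall>i\<in>{1..CARD('n)}. 0 \<le> u i"
  shows "PF u = {x :: real ^ 'n. (\<forall>j. 0 \<le> x $ j) \<and> (\<forall>S. (\<Sum>j\<in>S. x $ j) \<le> topsum CARD('n) u (card S))}"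
    (is "_ = ?P")
proof
  have "convex ?P"
  proof -
    have "?P = (\<Inter>j. {x. 0 \<le> axis j 1 \<bullet> x}) \<inter> (\<Inter>S. {x. (\<Sum>j\<in>S. axis j 1) \<bullet> x \<le> topsum CARD('n) u (card S)})"
      by (auto simp: inner_axis' inner_sum_left)
    thus ?thesis by (auto intro!: convex_Int convex_INT convex_halfspace_le convex_halfspace_ge)
  qed
  thus "PF u \<subseteq> ?P"
    unfolding PF_def using sum_parking_function_le[OF u]
    by (intro hull_minimal) (auto simp: is_parking_function_def)
next
  let ?n = "CARD('n)"
  have PF: "closed (PF u :: (real ^ 'n) set)" "convex (PF u :: (real ^ 'n) set)"
    unfolding PF_def using compact_parking_functions[OF u]
    by (auto intro!: compact_imp_closed compact_convex_hull convex_convex_hull)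
  show "?P \<subseteq> PF u"
  proof (rule ccontr)
    assume "\<not> ?P \<subseteq> PF u"
    then obtain x where x: "x \<in> ?P" "x \<notin> PF u" by auto
    from separating_hyperplane_closed_point[OF PF(2,1) x(2)] obtain c b
      where cb: "c \<bullet> x < b" "\<forall>y\<in>PF u. b < c \<bullet> y" by auto
    \<comment> \<open>The separation puts \<open>x\<close> on the low side of \<open>c\<close>; the
      sign change makes this a maximisation problem.\<close>
    define e where "e = - c"
    obtain ys where ys: "distinct ys" "set ys = (UNIV :: 'n set)" "length ys = ?n" "sorted (map (($) e) ys)"
      using obtain_sorted_enumeration[of "($) e"] by blast
    define \<sigma> where "\<sigma> i = ys ! (i - 1)" for i
    have \<sigma>: "bij_betw \<sigma> {1..?n} UNIV"
    proof -
      have "bij_betw ((!) ys) {..<?n} UNIV" using bij_betw_nth[OF ys(1), of "{..<?n}" UNIV] ys by simp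
      moreover have "bij_betw (\<lambda>i. i - 1) {1..?n} {..<?n}"
        by (rule bij_betw_byWitness[where f' = Suc]) auto
      ultimately have "bij_betw ((!) ys \<circ> (\<lambda>i. i - 1)) {1..?n} UNIV" by (rule bij_betw_trans[rotated])
      thus ?thesis by (simp add: comp_def \<sigma>_def[abs_def])
    qed
    have mono: "mono_on {1..?n} (\<lambda>i. max 0 (e $ \<sigma> i))"
    proof (rule mono_onI)
      fix i j assume ij: "i \<in> {1..?n}" "j \<in> {1..?n}" "i \<le> j"
      have "map (($) e) ys ! (i - 1) \<le> map (($) e) ys ! (j - 1)"
        using ij ys(3) by (intro sorted_nth_mono[OF ys(4)]) auto
      moreover have "i - 1 < length ys" "j - 1 < length ys" using ij ys(3) by auto
      ultimately show "max 0 (e $ \<sigma> i) \<le> max 0 (e $ \<sigma> j)" by (simp add: \<sigma>_def)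
    qed
    \<comment> \<open>The maximiser: larger entries of \<open>u\<close> go to larger entries of
      \<open>e\<close>, and coordinates where \<open>e\<close> is not positive are set to 0.\<close>
    define a :: "real ^ 'n" where
      "a = (\<chi> j. if 0 < e $ j then u (the_inv_into {1..?n} \<sigma> j) else 0)"
    have a\<sigma>: "a $ \<sigma> i = (if 0 < e $ \<sigma> i then u i else 0)" if "i \<in> {1..?n}" for i
      using \<sigma> that by (simp add: a_def bij_betw_def the_inv_into_f_f)
    have "0 \<le> a $ j" for j
    proof -
      obtain i where "i \<in> {1..?n}" "j = \<sigma> i" using \<sigma> unfolding bij_betw_def by (metis UNIV_I imageE)
      thus ?thesis using a\<sigma> nonneg by simp
    qed
    hence "is_parking_function u a" unfolding is_parking_function_iff[OF u]
      using \<sigma> a\<sigma> nonneg by (intro conjI exI[of _ \<sigma>]) auto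
    hence "a \<in> PF u" unfolding PF_def by (auto intro: hull_inc)
    hence "c \<bullet> x < c \<bullet> a" using cb by force
    hence less: "e \<bullet> a < e \<bullet> x" by (simp add: e_def)
    have "e \<bullet> x = (\<Sum>i\<in>{1..?n}. e $ \<sigma> i * x $ \<sigma> i)"
      unfolding inner_vec_def using sum.reindex_bij_betw[OF \<sigma>, of "\<lambda>j. e $ j * x $ j"] by simp
    also have "\<dots> \<le> (\<Sum>i\<in>{1..?n}. max 0 (e $ \<sigma> i) * x $ \<sigma> i)"
      using x(1) by (intro sum_mono mult_right_mono) auto
    finally have 1: "e \<bullet> x \<le> (\<Sum>i\<in>{1..?n}. max 0 (e $ \<sigma> i) * x $ \<sigma> i)" .
    have "e \<bullet> a = (\<Sum>i\<in>{1..?n}. e $ \<sigma> i * a $ \<sigma> i)"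
      unfolding inner_vec_def using sum.reindex_bij_betw[OF \<sigma>, of "\<lambda>j. e $ j * a $ j"] by simp
    also have "\<dots> = (\<Sum>i\<in>{1..?n}. max 0 (e $ \<sigma> i) * u i)"
      by (intro sum.cong refl) (use a\<sigma> in auto)
    finally have 2: "e \<bullet> a = (\<Sum>i\<in>{1..?n}. max 0 (e $ \<sigma> i) * u i)" .
    have "0 \<le> (\<Sum>i\<in>{1..?n}. max 0 (e $ \<sigma> i) * (u i - x $ \<sigma> i))"
    proof (rule sum_mult_nonneg_tails[OF mono])
      fix j assume j: "j \<in> {1..?n}"
      have inj: "inj_on \<sigma> {j..?n}" using \<sigma> j by (auto simp: bij_betw_def intro: inj_on_subset)
      have "(\<Sum>i\<in>{j..?n}. x $ \<sigma> i) = (\<Sum>i\<in>\<sigma> ` {j..?n}. x $ i)" using inj by (simp add: sum.reindex)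
      also have "\<dots> \<le> topsum ?n u (card (\<sigma> ` {j..?n}))" using x(1) by auto
      also have "card (\<sigma> ` {j..?n}) = ?n + 1 - j" using inj by (simp add: card_image)
      also have "topsum ?n u (?n + 1 - j) = sum u {j..?n}"
        unfolding topsum_def using j by (intro arg_cong[of _ _ "sum u"]) auto
      finally show "0 \<le> (\<Sum>i\<in>{j..?n}. u i - x $ \<sigma> i)" by (simp add: sum_subtractf)
    qed auto
    with 1 2 less show False by (simp add: right_diff_distrib sum_subtractf)
  qed
qed

section \<open>Support functions and the signed decomposition\<close>

text \<open>The indicator of the \<open>k\<close>-th term increases exactly at the first element in
  \<open>J k\<close>, and there it picks up \<open>l\<close> of that element. Sets
  \<open>J k\<close> already met by \<open>S\<close> contribute nothing more.\<close>

lemma greedy_sum: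
  assumes "\<And>S. w S = (\<Sum>k\<in>K. y k * of_bool (S \<inter> J k \<noteq> {}))"
  shows "greedy l w S xs = (\<Sum>k\<in>K. y k * (if S \<inter> J k \<noteq> {} then 0 else hit l (J k) xs))"
proof (induction xs arbitrary: S)
  case Nil
  show ?case unfolding greedy.simps by (rule sum.neutral[symmetric]) simp
next
  case (Cons a xs)
  have "greedy l w S (a # xs) = (\<Sum>k\<in>K. l a * (y k * of_bool (insert a S \<inter> J k \<noteq> {}) - y k * of_bool (S \<inter> J k \<noteq> {}))
      + y k * (if insert a S \<inter> J k \<noteq> {} then 0 else hit l (J k) xs))"
    by (simp only: greedy.simps assms Cons.IH sum.distrib sum_subtractf[symmetric] sum_distrib_left)
  also have "\<dots> = (\<Sum>k\<in>K. y k * (if S \<inter> J k \<noteq> {} then 0 else hit l (J k) (a # xs)))"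
    by (intro sum.cong refl) auto
  finally show ?case .
qed

text \<open>A value of the support function, required to be attained; additivity under Minkowski
  sums then needs no suprema.\<close>

definition is_max :: "('v \<Rightarrow> real) \<Rightarrow> 'v set \<Rightarrow> real \<Rightarrow> bool" where
  "is_max f A M \<longleftrightarrow> (\<exists>x\<in>A. f x = M) \<and> (\<forall>x\<in>A. f x \<le> M)"

lemma is_max_unique: "is_max f A M \<Longrightarrow> is_max f A M' \<Longrightarrow> M = M'"
  unfolding is_max_def by (metis order_antisym)

lemma is_max_plus:
  assumes f: "linear f" and "is_max f A M" "is_max f B M'"
  shows "is_max f (A + B) (M + M')"
proof -
  obtain a b where "a \<in> A" "f a = M" "b \<in> B" "f b = M'" using assms by (auto simp: is_max_def)
  hence "a + b \<in> A + B" "f (a + b) = M + M'" using f by (auto simp: linear_add)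
  moreover have "f x \<le> M + M'" if "x \<in> A + B" for x
    using that assms by (auto simp: is_max_def set_plus_def linear_add intro!: add_mono)
  ultimately show ?thesis unfolding is_max_def by blast
qed

lemma is_max_sum:
  assumes f: "linear f" and "finite K" "\<And>k. k \<in> K \<Longrightarrow> is_max f (A k) (M k)"
  shows "is_max f (\<Sum>k\<in>K. A k) (\<Sum>k\<in>K. M k)"
  using assms(2,3)
proof (induction K)
  case empty
  thus ?case using f by (simp add: is_max_def linear_0)
qed (auto intro: is_max_plus[OF f])

lemma is_max_simplex0:
  fixes I :: "'n::finite set"
  assumes "0 \<le> c"
  shows "is_max (\<lambda>x. \<Sum>j\<in>S. x $ j) ((\<lambda>x. c *\<^sub>R x) ` simplex0 I) (c * of_bool (S \<inter> I \<noteq> {}))"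
proof -
  let ?f = "\<lambda>x :: real ^ 'n. \<Sum>j\<in>S. x $ j"
  have axis: "?f (axis i 1) = of_bool (i \<in> S)" for i by (simp add: axis_def)
  have le: "?f x \<le> of_bool (S \<inter> I \<noteq> {})" if "x \<in> simplex0 I" for x
  proof -
    have eq: "{x. ?f x \<le> b} = {x. (\<Sum>j\<in>S. axis j 1) \<bullet> x \<le> b}" for b
      by (simp add: inner_axis' inner_sum_left)
    have "simplex0 I \<subseteq> {x. ?f x \<le> of_bool (S \<inter> I \<noteq> {})}"
      unfolding simplex0_def
    proof (rule hull_minimal)
      show "convex {x. ?f x \<le> of_bool (S \<inter> I \<noteq> {})}" unfolding eq by (rule convex_halfspace_le)
    qed (auto simp: axis)
    from subsetD[OF this that] show ?thesis by (rule CollectD)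
  qed
  have ex: "\<exists>x\<in>simplex0 I. ?f x = of_bool (S \<inter> I \<noteq> {})"
  proof (cases "S \<inter> I = {}")
    case True
    have "0 \<in> simplex0 I" unfolding simplex0_def by (rule hull_inc) simp
    thus ?thesis using True by (intro bexI[of _ 0]) auto
  next
    case False
    then obtain i where "i \<in> S" "i \<in> I" by auto
    hence "axis i 1 \<in> simplex0 I" unfolding simplex0_def by (intro hull_inc) auto
    thus ?thesis using False \<open>i \<in> S\<close> axis by (intro bexI[of _ "axis i 1"]) auto
  qed
  have scale: "?f (c *\<^sub>R x) = c * ?f x" for x by (simp add: sum_distrib_left)
  show ?thesis
    unfolding is_max_def
  proof (intro conjI ballI)
    show "\<exists>x\<in>(*\<^sub>R) c ` simplex0 I. ?f x = c * of_bool (S \<inter> I \<noteq> {})"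
      using ex scale by (metis (no_types, lifting) imageI)
    fix x assume "x \<in> (*\<^sub>R) c ` simplex0 I"
    then obtain z where "z \<in> simplex0 I" "x = c *\<^sub>R z" by auto
    thus "?f x \<le> c * of_bool (S \<inter> I \<noteq> {})" using scale le[of z] assms by (simp add: mult_left_mono)
  qed
qed

text \<open>Take the maximum of the coordinate sum over \<open>S\<close> on both sides of the
  Minkowski identity; as an equation between numbers, the negative terms can be moved back.\<close>

lemma topsum_eq_sum_y:
  fixes S :: "'n::finite set" and I :: "nat \<Rightarrow> 'n set"
  assumes u: "mono_on {1..CARD('n)} u" and nonneg: "\<forall>i\<in>{1..CARD('n)}. 0 \<le> u i"
    and K: "finite K"
    and dec: "is_signed_minkowski_sum (PF u :: (real ^ 'n) set) K y (\<lambda>k. simplex0 (I k))"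
  shows "topsum CARD('n) u (card S) = (\<Sum>k\<in>K. y k * of_bool (S \<inter> I k \<noteq> {}))"
proof -
  let ?f = "\<lambda>x :: real ^ 'n. \<Sum>j\<in>S. x $ j"
  let ?r = "\<lambda>k. of_bool (S \<inter> I k \<noteq> {}) :: real"
  let ?N = "{k \<in> K. y k < 0}" and ?P = "{k \<in> K. y k > 0}"
  have lin: "linear ?f" by (intro linear_compose_sum ballI) (simp add: bounded_linear.linear bounded_linear_vec_nth)
  have "is_max ?f (PF u) (topsum CARD('n) u (card S))"
    unfolding is_max_def
  proof
    show "\<exists>x\<in>PF u. ?f x = topsum CARD('n) u (card S)"
      using exists_parking_function_topsum[OF u nonneg, of S] unfolding PF_def by (auto intro: hull_inc)
    show "\<forall>x\<in>PF u. ?f x \<le> topsum CARD('n) u (card S)"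
      unfolding PF_eq[OF u nonneg] by blast
  qed
  moreover have "is_max ?f (\<Sum>k\<in>?N. (\<lambda>x. (- y k) *\<^sub>R x) ` simplex0 (I k)) (\<Sum>k\<in>?N. - y k * ?r k)"
    using K by (intro is_max_sum[OF lin] is_max_simplex0) auto
  ultimately have "is_max ?f (PF u + (\<Sum>k\<in>?N. (\<lambda>x. (- y k) *\<^sub>R x) ` simplex0 (I k)))
      (topsum CARD('n) u (card S) + (\<Sum>k\<in>?N. - y k * ?r k))"
    by (rule is_max_plus[OF lin])
  moreover have "is_max ?f (\<Sum>k\<in>?P. (\<lambda>x. y k *\<^sub>R x) ` simplex0 (I k)) (\<Sum>k\<in>?P. y k * ?r k)"
    using K by (intro is_max_sum[OF lin] is_max_simplex0) auto
  ultimately have "topsum CARD('n) u (card S) + (\<Sum>k\<in>?N. - y k * ?r k) = (\<Sum>k\<in>?P. y k * ?r k)"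
    using dec unfolding is_signed_minkowski_sum_def by (metis (no_types, lifting) is_max_unique)
  moreover have "(\<Sum>k\<in>K. y k * ?r k) = (\<Sum>k\<in>?N \<union> ?P. y k * ?r k)"
    using K by (intro sum.mono_neutral_right) auto
  moreover have "\<dots> = (\<Sum>k\<in>?N. y k * ?r k) + (\<Sum>k\<in>?P. y k * ?r k)"
    using K by (intro sum.union_disjoint) auto
  ultimately show ?thesis by (simp add: sum_negf)
qed

text \<open>Inside \<open>T\<close> submodularity is the concavity of \<open>topsum\<close>. If only
  one of two sets contains the slack element \<open>v\<close>, it and the union both have full rank,
  and monotonicity remains to be used.\<close>

lemma rank_fun_topsum:
  fixes v :: 'a
  assumes u: "mono_on {1..n} u" and nonneg: "\<forall>i\<in>{1..n}. 0 \<le> u i"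
    and T: "finite T" "card T = n" "v \<notin> T"
    and w: "\<And>S. S \<subseteq> T \<Longrightarrow> w S = topsum n u (card S)" "\<And>S. S \<subseteq> T \<Longrightarrow> w (insert v S) = topsum n u n"
  shows "rank_fun (insert v T) w"
proof -
  have ws: "w S = (if v \<in> S then topsum n u n else topsum n u (card S))" if "S \<subseteq> insert v T" for S
  proof (cases "v \<in> S")
    case True
    thus ?thesis using w(2)[of "S - {v}"] that by (auto simp: insert_absorb)
  next
    case False
    thus ?thesis using w(1)[of S] that by auto
  qed
  have le: "topsum n u (card S) \<le> topsum n u (card S')" if "S \<subseteq> S'" "S' \<subseteq> T" for S S'
    using that T(1) by (intro topsum_mono nonneg card_mono) (auto dest: finite_subset)
  have le': "topsum n u (card S) \<le> topsum n u n" if "S \<subseteq> T" for S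
    using le[of S T] that T by simp
  have sub: "topsum n u (card (A \<union> B)) + topsum n u (card (A \<inter> B)) \<le> topsum n u (card A) + topsum n u (card B)"
    if AB: "A \<subseteq> T" "B \<subseteq> T" for A B
  proof -
    have fin: "finite A" "finite B" using AB T(1) finite_subset by auto
    have c: "card (A \<union> B) = card B + card (A - B)" "card A = card (A \<inter> B) + card (A - B)"
      using fin by (metis Un_Diff_cancel2 Diff_disjoint Int_commute Un_commute card_Un_disjoint finite_Diff,
        metis Int_Diff_disjoint Int_Diff_Un card_Un_disjoint finite_Diff finite_Int)
    have "card (A \<union> B) \<le> n" using AB T card_mono[of T "A \<union> B"] by auto
    hence "topsum n u (card B + card (A - B)) - topsum n u (card B)
      \<le> topsum n u (card (A \<inter> B) + card (A - B)) - topsum n u (card (A \<inter> B))"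
      using c fin by (intro topsum_concave[OF u]) (auto intro: card_mono)
    thus ?thesis using c by simp
  qed
  show ?thesis
    unfolding rank_fun_def
  proof (intro conjI allI impI)
    show "w {} = 0" using w(1)[of "{}"] by simp
    show "w A \<le> w B" if "A \<subseteq> B" "B \<subseteq> insert v T" for A B
      using that ws[of A] ws[of B] le[of A B] le'[of A] by auto
    fix A B assume AB: "A \<subseteq> insert v T" "B \<subseteq> insert v T"
    have wu: "w (A \<union> B) = (if v \<in> A \<union> B then topsum n u n else topsum n u (card (A \<union> B)))"
      and wi: "w (A \<inter> B) = (if v \<in> A \<inter> B then topsum n u n else topsum n u (card (A \<inter> B)))"
      using AB by (intro ws; auto)+
    show "w (A \<union> B) + w (A \<inter> B) \<le> w A + w B"
    proof (cases "v \<in> A"; cases "v \<in> B")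
      assume v: "v \<in> A" "v \<notin> B"
      hence "A \<inter> B \<subseteq> B" "B \<subseteq> T" using AB by auto
      thus ?thesis using le[of "A \<inter> B" B] v ws[OF AB(1)] ws[OF AB(2)] wu wi by simp
    next
      assume v: "v \<notin> A" "v \<in> B"
      hence "A \<inter> B \<subseteq> A" "A \<subseteq> T" using AB by auto
      thus ?thesis using le[of "A \<inter> B" A] v ws[OF AB(1)] ws[OF AB(2)] wu wi by simp
    next
      assume v: "v \<notin> A" "v \<notin> B"
      hence "A \<subseteq> T" "B \<subseteq> T" using AB by auto
      thus ?thesis using sub[of A B] v ws[OF AB(1)] ws[OF AB(2)] wu wi by simp
    qed (use ws[OF AB(1)] ws[OF AB(2)] wu wi in simp)
  qed
qed

section \<open>Transfer to Lebesgue measure and to the draconian condition\<close>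

text \<open>Lebesgue measure is the image of the product measure on coordinate functions, which is
  where the integrals over sections live.\<close>

lemma emeasure_base_body:
  fixes P :: "'a::euclidean_space set"
  assumes P: "P \<in> sets borel"
    and body: "\<And>f. (\<Sum>b\<in>Basis. f b *\<^sub>R b) \<in> P \<longleftrightarrow> f \<in> base_body v Basis w"
  shows "emeasure lborel P = (\<integral>\<^sup>+f. indicator (base_body v Basis w) f \<partial>Pi\<^sub>M (Basis :: 'a set) (\<lambda>_. lborel))"
proof -
  let ?M = "Pi\<^sub>M (Basis :: 'a set) (\<lambda>_. lborel :: real measure)"
  let ?h = "\<lambda>f. \<Sum>b\<in>Basis. f b *\<^sub>R (b :: 'a)"
  have h: "?h \<in> ?M \<rightarrow>\<^sub>M borel" by measurable
  have "emeasure lborel P = emeasure (distr ?M borel ?h) P" by (subst lborel_eq) (rule refl)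
  also have "\<dots> = emeasure ?M (?h -` P \<inter> space ?M)" using h P by (rule emeasure_distr)
  also have "?h -` P \<inter> space ?M = base_body v Basis w \<inter> space ?M" using body by auto
  also have "emeasure ?M \<dots> = (\<integral>\<^sup>+f. indicator (base_body v Basis w \<inter> space ?M) f \<partial>?M)"
    by (rule nn_integral_indicator[symmetric, OF base_body_measurable]) simp
  also have "\<dots> = (\<integral>\<^sup>+f. indicator (base_body v Basis w) f \<partial>?M)"
    by (intro nn_integral_cong) (auto simp: indicator_def)
  finally show ?thesis .
qed

text \<open>Hall's condition for the family in which \<open>I k\<close> is repeated
  \<open>a k\<close> times. The union sees only which \<open>k\<close> occur, so the strongest
  instances take all copies of each chosen \<open>k\<close>, and these are the draconian
  inequalities.\<close>

lemma draconian_iff: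
  fixes I :: "nat \<Rightarrow> 'n::finite set" and f :: "'n \<Rightarrow> 'b"
  assumes a: "a \<in> {1..m} \<rightarrow>\<^sub>E UNIV" and f: "inj f" "v \<notin> range f"
  shows "a \<in> draconian m I \<longleftrightarrow>
    (\<forall>Q\<subseteq>(SIGMA k:{1..m}. {..<a k}). card Q \<le> card (\<Union>q\<in>Q. insert v (f ` I (fst q)) - {v}))"
proof -
  let ?K = "SIGMA k:{1..m}. {..<a k}"
  have un: "card (\<Union>q\<in>Q. insert v (f ` I (fst q)) - {v}) = card (\<Union>k\<in>fst ` Q. I k)" for Q :: "(nat \<times> nat) set"
  proof -
    have "(\<Union>q\<in>Q. insert v (f ` I (fst q)) - {v}) = f ` (\<Union>k\<in>fst ` Q. I k)" using f(2) by auto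
    thus ?thesis using f(1) by (simp add: card_image inj_on_subset)
  qed
  show ?thesis unfolding un
  proof
    assume d: "a \<in> draconian m I"
    show "\<forall>Q\<subseteq>?K. card Q \<le> card (\<Union>k\<in>fst ` Q. I k)"
    proof (intro allI impI)
      fix Q assume Q: "Q \<subseteq> ?K"
      show "card Q \<le> card (\<Union>k\<in>fst ` Q. I k)"
      proof (cases "Q = {}")
        case False
        let ?J = "fst ` Q"
        have J: "?J \<subseteq> {1..m}" "?J \<noteq> {}" using Q False by auto
        have "Q \<subseteq> (SIGMA k:?J. {..<a k})" using Q by force
        hence "card Q \<le> card (SIGMA k:?J. {..<a k})"
          using finite_subset[OF J(1)] by (intro card_mono finite_SigmaI) auto
        also have "\<dots> = (\<Sum>k\<in>?J. a k)" using finite_subset[OF J(1)] by (subst card_SigmaI) auto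
        also have "\<dots> \<le> card (\<Union>k\<in>?J. I k)" using d J unfolding draconian_def by blast
        finally show ?thesis .
      qed simp
    qed
  next
    assume h: "\<forall>Q\<subseteq>?K. card Q \<le> card (\<Union>k\<in>fst ` Q. I k)"
    have "(\<Sum>j\<in>J. a j) \<le> card (\<Union>j\<in>J. I j)" if J: "J \<subseteq> {1..m}" for J
    proof -
      let ?Q = "SIGMA k:J. {..<a k}"
      have "(\<Sum>j\<in>J. a j) = card ?Q" using finite_subset[OF J] by (subst card_SigmaI) auto
      also have "\<dots> \<le> card (\<Union>k\<in>fst ` ?Q. I k)"
      proof -
        have "?Q \<subseteq> ?K" using J by blast
        thus ?thesis using h by blast
      qed
      also have "\<dots> \<le> card (\<Union>k\<in>J. I k)" by (intro card_mono) auto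
      finally show ?thesis .
    qed
    thus "a \<in> draconian m I" using a unfolding draconian_def by blast
  qed
qed

theorem corollary7p7:
  fixes u :: "nat \<Rightarrow> real"
    and m :: nat
    and I :: "nat \<Rightarrow> ('n::finite) set"
  assumes nonneg: "0 \<le> u 1"
    and nondecreasing: "mono_on {1..CARD('n)} u"
    and nonzero: "\<exists>i\<in>{1..CARD('n)}. u i \<noteq> 0"
    and full_dim: "aff_dim (PF u :: (real ^ 'n) set) = int CARD('n)"
    and distinct: "inj_on I {1..m}"
    and nonempty: "\<And>k. k \<in> {1..m} \<Longrightarrow> I k \<noteq> {}"
    and y_nonzero: "\<And>k. k \<in> {1..m} \<Longrightarrow> y_coeff u (I k) \<noteq> 0"
    and decomposition:
      "is_signed_minkowski_sum (PF u :: (real ^ 'n) set) {1..m}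
         (\<lambda>k. y_coeff u (I k)) (\<lambda>k. simplex0 (I k))"
  shows "measure lebesgue (PF u :: (real ^ 'n) set) =
    (\<Sum>a \<in> {a \<in> draconian m I. (\<Sum>k = 1..m. a k) = CARD('n)}.
       \<Prod>k = 1..m. y_coeff u (I k) ^ a k / fact (a k))"
proof -
  let ?n = "CARD('n)"
  let ?T = "Basis :: (real ^ 'n) set"
  define N where "N = insert 0 ?T"
  define y where "y k = y_coeff u (I k)" for k
  let ?ax = "\<lambda>i. axis i 1 :: real ^ 'n"
  \<comment> \<open>The origin, the common vertex of the simplices, plays the role of the slack coordinate.\<close>
  define J where "J k = insert 0 (?ax ` I k)" for k
  \<comment> \<open>Linear in \<open>y\<close> by definition; \<open>wT\<close> and
    \<open>w0\<close> identify it with the rank function of \<open>PF u\<close>.\<close>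
  define w where "w S = (\<Sum>k\<in>{1..m}. y k * of_bool (S \<inter> J k \<noteq> {}))" for S
  note u = nondecreasing
  have u0: "\<forall>i\<in>{1..?n}. 0 \<le> u i"
  proof
    fix i assume "i \<in> {1..?n}"
    thus "0 \<le> u i" using mono_onD[OF u, of 1 i] nonneg by auto
  qed
  have inj: "inj ?ax" by (auto simp: inj_on_def axis_eq_axis)
  have ran: "range ?ax = ?T" by (auto simp: Basis_vec_def)
  have card_ax: "card (?ax ` S) = card S" for S using inj by (simp add: card_image inj_on_subset)
  have cardT: "card ?T = ?n" by simp
  have ax0: "?ax i \<noteq> 0" for i using ran nonzero_Basis by blast
  have wT: "w (?ax ` S) = topsum ?n u (card S)" for S
  proof -
    have "?ax ` S \<inter> J k \<noteq> {} \<longleftrightarrow> S \<inter> I k \<noteq> {}" for k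
      using inj ax0 by (auto simp: J_def inj_on_def)
    thus ?thesis unfolding w_def
      using topsum_eq_sum_y[OF u u0 _ decomposition, of S] by (simp add: y_def)
  qed
  \<comment> \<open>Both \<open>insert 0 S\<close> and the full coordinate set meet everything:
    every \<open>J k\<close> contains 0 and every \<open>I k\<close> is nonempty.\<close>
  have w0: "w (insert 0 S) = topsum ?n u ?n" for S
  proof -
    have "w (insert 0 S) = (\<Sum>k\<in>{1..m}. y k * of_bool (UNIV \<inter> I k \<noteq> {}))"
      unfolding w_def by (intro sum.cong refl) (use nonempty in \<open>auto simp: J_def\<close>)
    thus ?thesis using topsum_eq_sum_y[OF u u0 _ decomposition, of UNIV] by (simp add: y_def)
  qed
  have rank: "rank_fun N w"
    unfolding N_def
  proof (rule rank_fun_topsum[OF u u0 _ cardT])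
    fix S assume "S \<subseteq> ?T"
    then obtain S' where "S = ?ax ` S'" using ran by (metis subset_imageE)
    thus "w S = topsum ?n u (card S)" using wT card_ax by simp
  qed (use w0 in auto)
  have PF: "PF u = {x :: real ^ 'n. (\<forall>j. 0 \<le> x $ j) \<and> (\<forall>S. (\<Sum>j\<in>S. x $ j) \<le> topsum ?n u (card S))}"
    by (rule PF_eq[OF u u0])
  have body: "(\<Sum>b\<in>Basis. f b *\<^sub>R b) \<in> (PF u :: (real ^ 'n) set) \<longleftrightarrow> f \<in> base_body 0 Basis w" for f
  proof -
    let ?x = "\<Sum>b\<in>Basis. f b *\<^sub>R b :: real ^ 'n"
    have x: "?x $ j = f (?ax j)" for j
    proof -
      have "?x \<bullet> ?ax j = f (?ax j)" by (rule inner_sum_left_Basis) (simp add: ran[symmetric])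
      thus ?thesis by (simp add: inner_axis)
    qed
    have "f \<in> base_body 0 ?T w \<longleftrightarrow> (\<forall>S. sum f (?ax ` S) \<le> w (?ax ` S) \<and> w N - w (N - ?ax ` S) \<le> sum f (?ax ` S))"
      unfolding base_body_def N_def mem_Collect_eq ran[symmetric] all_subset_image by blast
    also have "\<dots> \<longleftrightarrow> (\<forall>S. (\<Sum>j\<in>S. ?x $ j) \<le> topsum ?n u (card S) \<and> 0 \<le> (\<Sum>j\<in>S. ?x $ j))"
    proof -
      have "sum f (?ax ` S) = (\<Sum>j\<in>S. ?x $ j)" for S
        unfolding x using inj by (simp add: sum.reindex inj_on_subset)
      \<comment> \<open>The complement still contains the origin and so has full rank; hence the
        lower bounds just say that the coordinates are nonnegative.\<close>
      moreover have "w N - w (N - ?ax ` S) = 0" for S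
      proof -
        have "N - ?ax ` S = insert 0 (N - ?ax ` S)" using ax0 by (auto simp: N_def)
        thus ?thesis using w0 by (metis N_def diff_self)
      qed
      ultimately show ?thesis by (simp add: wT)
    qed
    also have "\<dots> \<longleftrightarrow> ?x \<in> PF u"
    proof -
      have "(\<forall>S. 0 \<le> (\<Sum>j\<in>S. ?x $ j)) \<longleftrightarrow> (\<forall>j. 0 \<le> ?x $ j)"
      proof
        assume *: "\<forall>S. 0 \<le> (\<Sum>j\<in>S. ?x $ j)"
        show "\<forall>j. 0 \<le> ?x $ j" using *[rule_format, of "{_}"] by simp
      qed (simp add: sum_nonneg)
      thus ?thesis unfolding PF by blast
    qed
    finally show ?thesis ..
  qed
  have closed: "PF u \<in> sets (borel :: (real ^ 'n) measure)"
    unfolding PF_def using compact_parking_functions[OF u]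
    by (intro borel_closed compact_imp_closed compact_convex_hull)
  obtain g where g: "bij_betw g ?T {0..<?n}" using ex_bij_betw_finite_nat[of ?T] cardT by auto
  \<comment> \<open>A concrete generic form: 0 at the slack element and distinct positive integers
    on the basis; \<open>Suc\<close> keeps these apart from 0.\<close>
  define l where "l b = (if b = 0 then 0 else real (Suc (g b)))" for b :: "real ^ 'n"
  have injl: "inj_on l N"
    using g nonzero_Basis by (auto simp: inj_on_def l_def N_def bij_betw_def)
  note V = nn_integral_base_body[of ?T 0 l w 0 0, OF _ _ injl[unfolded N_def] _ _ rank[unfolded N_def]]
  define R where "R = (\<Sum>xs\<in>permutations_of_set N. weight l xs * greedy l w {} xs ^ ?n) / fact ?n"
  have "0 \<le> R \<and> emeasure lborel (PF u :: (real ^ 'n) set) = ennreal R"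
    unfolding emeasure_base_body[OF closed body] using V by (simp add: R_def N_def l_def)
  hence "measure lborel (PF u :: (real ^ 'n) set) = R" by (simp add: measure_def)
  hence vol: "measure lebesgue (PF u :: (real ^ 'n) set) = R" using closed by (simp add: measure_completion)
  have greedy: "greedy l w {} xs = (\<Sum>k\<in>{1..m}. y k * hit l (J k) xs)" for xs
    by (subst greedy_sum[OF w_def]) simp
  define C where "C = compositions {1..m} ?n"
  have "R = (\<Sum>xs\<in>permutations_of_set N. \<Sum>a\<in>C. weight l xs * (\<Prod>k\<in>{1..m}. (y k * hit l (J k) xs) ^ a k / fact (a k)))"
    unfolding R_def greedy multinomial_theorem[OF finite_atLeastAtMost] C_def[symmetric]
    by (simp add: sum_divide_distrib sum_distrib_left)
  also have "\<dots> = (\<Sum>a\<in>C. \<Sum>xs\<in>permutations_of_set N. weight l xs * (\<Prod>k\<in>{1..m}. (y k * hit l (J k) xs) ^ a k / fact (a k)))"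
    by (rule sum.swap)
  also have "\<dots> = (\<Sum>a\<in>C. if a \<in> draconian m I then \<Prod>k\<in>{1..m}. y k ^ a k / fact (a k) else 0)"
  proof (rule sum.cong[OF refl])
    fix a assume a: "a \<in> C"
    \<comment> \<open>One index for each of the \<open>a k\<close> copies of \<open>k\<close>, so
      that the powers become a product over \<open>?K\<close>, with \<open>card ?K = ?n\<close>, the
      critical size.\<close>
    let ?K = "SIGMA k:{1..m}. {..<a k}"
    let ?J = "\<lambda>q :: nat \<times> nat. J (fst q)"
    have prod: "(\<Prod>k\<in>{1..m}. (y k * hit l (J k) xs) ^ a k / fact (a k)) =
       (\<Prod>k\<in>{1..m}. y k ^ a k / fact (a k)) * (\<Prod>q\<in>?K. hit l (?J q) xs)" for xs
    proof -
      have "(\<Prod>q\<in>?K. hit l (?J q) xs) = (\<Prod>k\<in>{1..m}. \<Prod>i<a k. hit l (J k) xs)"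
        by (subst prod.Sigma) (auto simp: split_def)
      thus ?thesis by (simp add: power_mult_distrib prod.distrib prod_dividef)
    qed
    have "(\<Sum>xs\<in>permutations_of_set N. weight l xs * (\<Prod>k\<in>{1..m}. (y k * hit l (J k) xs) ^ a k / fact (a k)))
      = (\<Prod>k\<in>{1..m}. y k ^ a k / fact (a k)) * mixed_coeff l N ?K ?J"
      unfolding prod mixed_coeff_def by (simp add: sum_distrib_left mult_ac)
    also have "mixed_coeff l N ?K ?J = (if \<forall>Q\<subseteq>?K. card Q \<le> card (\<Union>q\<in>Q. ?J q - {0}) then 1 else 0)"
    proof (rule mixed_coeff_hall[OF _ injl])
      have "card ?K = sum a {1..m}" by (subst card_SigmaI) auto
      also have "\<dots> = ?n" using a by (simp add: C_def compositions_def)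
      finally show "card ?K + 1 = card N" by (simp add: N_def)
      show "?J q \<subseteq> N" if "q \<in> ?K" for q using ran by (auto simp: J_def N_def)
    qed (auto simp: N_def J_def)
    also have "(\<forall>Q\<subseteq>?K. card Q \<le> card (\<Union>q\<in>Q. ?J q - {0})) \<longleftrightarrow> a \<in> draconian m I"
      unfolding J_def using a ax0
      by (intro draconian_iff[symmetric] inj) (auto simp: C_def compositions_def)
    finally show "(\<Sum>xs\<in>permutations_of_set N. weight l xs * (\<Prod>k\<in>{1..m}. (y k * hit l (J k) xs) ^ a k / fact (a k)))
      = (if a \<in> draconian m I then \<Prod>k\<in>{1..m}. y k ^ a k / fact (a k) else 0)" by simp
  qed
  also have "\<dots> = (\<Sum>a\<in>{a \<in> C. a \<in> draconian m I}. \<Prod>k\<in>{1..m}. y k ^ a k / fact (a k))"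
    by (simp add: C_def sum.If_cases finite_compositions Int_def)
  also have "{a \<in> C. a \<in> draconian m I} = {a \<in> draconian m I. (\<Sum>k = 1..m. a k) = ?n}"
    by (auto simp: C_def compositions_def draconian_def)
  finally show ?thesis using vol by (simp add: y_def)
qed

end
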